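(* Let $Q$ be an $n$-element poset. The following conditions are equivalent: (a) The flag $h$-vector $\beta_{J(Q)}$ of $J(Q)$ is multiplicity-free (in which case, if $\beta_{J(Q)}(S)\ne0$ then $S$ is sparse). (b) For $0\le i\le n$, $J(Q)$ has at most two elements of rank $i$; equivalently, $Q$ has at most two $i$-element order ideals. (c) $Q$ is $(\mathbf{2}+\mathbf{2})$-free and $(\mathbf{1}+\mathbf{1}+\mathbf{1})$-free. Moreover, if $f(n)$ is the number of nonisomorphic $n$-element posets satisfying these conditions (with $f(0)=1$), then $$\sum_{n\ge0}f(n)x^n=\frac{1-2x}{(1-x)(1-2x-x^2)}.$$ If $g(n)$ is the number of such $n$-element posets which are not a nontrivial ordinal sum (equivalently, $J(Q)$ has exactly two elements of each rank $1\le i\le n-1$), then $g(1)=g(2)=1$ and $g(n)=2^{n-3}$ for $n\ge3$.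
   Context: $J(Q)$ is the distributive lattice of order ideals of $Q$ ordered by inclusion; it is graded of rank $n$ with rank function $I\mapsto \#I$, $\hat0=\emptyset$, $\hat1=Q$. For a finite graded poset $P$ of rank $n$ with $\hat0,\hat1$ and rank function $\rho$, the flag $f$-vector is $\alpha_P(S)=$ number of chains $C$ with $\{\rho(t):t\in C\}=S$ ($S\subseteq[n-1]$), and the flag $h$-vector is $\beta_P(S)=\sum_{T\subseteq S}(-1)^{\#(S-T)}\alpha_P(T)$; $\beta_P$ is multiplicity-free if all its values lie in $\{0,\pm1\}$. A set of integers is sparse if it contains no two consecutive integers. A poset is $(\mathbf{2}+\mathbf{2})$-free if it has no induced subposet isomorphic to a disjoint union of two 2-element chains, and $(\mathbf{1}+\mathbf{1}+\mathbf{1})$-free if it has no 3-element antichain. The ordinal sum $Q_1\oplus Q_2$ is the disjoint union with all relations of $Q_1$, of $Q_2$, and $s<t$ for all $s\in Q_1,t\in Q_2$; it is nontrivial if both $Q_1,Q_2$ are nonempty. *)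

theory Defs
  imports Complex_Main "HOL-Computational_Algebra.Formal_Power_Series"
begin

text \<open>
  A poset is a reflexive relation \<open>r\<close> with \<open>Partial_order r\<close>; its underlying set is \<open>Field r\<close>.
  The empty poset is allowed.
\<close>

definition poset_iso :: "'a rel \<Rightarrow> 'b rel \<Rightarrow> bool" where
  "poset_iso r s \<longleftrightarrow> (\<exists>f. bij_betw f (Field r) (Field s) \<and>
     (\<forall>x\<in>Field r. \<forall>y\<in>Field r. (x, y) \<in> r \<longleftrightarrow> (f x, f y) \<in> s))"

definition chain_poset :: "nat \<Rightarrow> nat rel" where
  "chain_poset k = relation_of (\<le>) {..<k}"

definition disjoint_sum :: "'a rel \<Rightarrow> 'b rel \<Rightarrow> ('a + 'b) rel" where
  "disjoint_sum r s = map_prod Inl Inl ` r \<union> map_prod Inr Inr ` s"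

definition two_plus_two_free :: "'a rel \<Rightarrow> bool" where
  "two_plus_two_free r \<longleftrightarrow>
     \<not> (\<exists>A\<subseteq>Field r. poset_iso (Restr r A) (disjoint_sum (chain_poset 2) (chain_poset 2)))"

definition antichain :: "'a rel \<Rightarrow> 'a set \<Rightarrow> bool" where
  "antichain r A \<longleftrightarrow> A \<subseteq> Field r \<and> (\<forall>x\<in>A. \<forall>y\<in>A. (x, y) \<in> r \<longrightarrow> x = y)"

definition one_plus_one_plus_one_free :: "'a rel \<Rightarrow> bool" where
  "one_plus_one_plus_one_free r \<longleftrightarrow> \<not> (\<exists>A. antichain r A \<and> card A = 3)"

definition ordinal_sum :: "'a rel \<Rightarrow> 'a rel \<Rightarrow> 'a rel" where
  "ordinal_sum r s = r \<union> s \<union> Field r \<times> Field s"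

definition nontrivial_ordinal_sum :: "'a rel \<Rightarrow> bool" where
  "nontrivial_ordinal_sum r \<longleftrightarrow> (\<exists>r1 r2. Partial_order r1 \<and> Partial_order r2 \<and>
     Field r1 \<noteq> {} \<and> Field r2 \<noteq> {} \<and> Field r1 \<inter> Field r2 = {} \<and> r = ordinal_sum r1 r2)"

definition order_ideals :: "'a rel \<Rightarrow> 'a set set" where
  "order_ideals r = {I. I \<subseteq> Field r \<and> (\<forall>t\<in>I. \<forall>s. (s, t) \<in> r \<longrightarrow> s \<in> I)}"

definition ideal_lattice :: "'a rel \<Rightarrow> 'a set rel" where
  "ideal_lattice r = relation_of (\<subseteq>) (order_ideals r)"

text \<open>
  The rank of \<open>t\<close> is the length of a longest chain below \<open>t\<close>, and the rank of the poset
  is the length of a longest chain. For a finite graded poset these are the usual rank function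
  and rank; for \<open>ideal_lattice r\<close> see \<open>elem_rank_ideal_lattice\<close> and \<open>poset_rank_ideal_lattice\<close> below.
\<close>

definition elem_rank :: "'a rel \<Rightarrow> 'a \<Rightarrow> nat" where
  "elem_rank r t = Max {card C - 1 |C. C \<in> Chains r \<and> C \<subseteq> under r t}"

definition poset_rank :: "'a rel \<Rightarrow> nat" where
  "poset_rank r = Max {card C - 1 |C. C \<in> Chains r}"

definition flag_f :: "'a rel \<Rightarrow> nat set \<Rightarrow> nat" where
  "flag_f r S = card {C \<in> Chains r. elem_rank r ` C = S}"

definition flag_h :: "'a rel \<Rightarrow> nat set \<Rightarrow> int" where
  "flag_h r S = (\<Sum>T\<in>Pow S. (- 1) ^ card (S - T) * int (flag_f r T))"

definition multiplicity_free_flag_h :: "'a rel \<Rightarrow> bool" where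
  "multiplicity_free_flag_h r \<longleftrightarrow>
     (\<forall>S \<subseteq> {1..poset_rank r - 1}. flag_h r S \<in> {- 1, 0, 1})"

definition sparse :: "nat set \<Rightarrow> bool" where
  "sparse S \<longleftrightarrow> (\<forall>i\<in>S. i + 1 \<notin> S)"

definition cond_a :: "'a rel \<Rightarrow> bool" where
  "cond_a r \<longleftrightarrow> multiplicity_free_flag_h (ideal_lattice r)"

definition cond_b :: "'a rel \<Rightarrow> bool" where
  "cond_b r \<longleftrightarrow>
     (\<forall>i\<in>{0..card (Field r)}. card {I \<in> Field (ideal_lattice r). elem_rank (ideal_lattice r) I = i} \<le> 2)"

definition cond_c :: "'a rel \<Rightarrow> bool" where
  "cond_c r \<longleftrightarrow> two_plus_two_free r \<and> one_plus_one_plus_one_free r"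

text \<open>
  Isomorphism classes of \<open>n\<close>-element posets are counted by means of representatives with
  underlying set \<open>{0, \<dots>, n - 1}\<close>.
\<close>

definition num_iso_classes :: "nat \<Rightarrow> (nat rel \<Rightarrow> bool) \<Rightarrow> nat" where
  "num_iso_classes n P =
     card ({r. Partial_order r \<and> Field r = {..<n} \<and> P r} // {(r, s). poset_iso r s})"

definition f_num :: "nat \<Rightarrow> nat" where
  "f_num n = num_iso_classes n (\<lambda>r. cond_a r \<and> cond_b r \<and> cond_c r)"

definition g_num :: "nat \<Rightarrow> nat" where
  "g_num n = num_iso_classes n
     (\<lambda>r. cond_a r \<and> cond_b r \<and> cond_c r \<and> \<not> nontrivial_ordinal_sum r)"

lemma Field_ideal_lattice: "Field (ideal_lattice r) = order_ideals r"
  by (auto simp: ideal_lattice_def Field_def relation_of_def)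

lemma Partial_order_ideal_lattice: "Partial_order (ideal_lattice r)"
  unfolding Field_ideal_lattice
  by (auto simp: ideal_lattice_def relation_of_def partial_order_on_def preorder_on_def refl_on_def
      trans_def antisym_def)

lemma Chains_ideal_lattice_iff:
  "C \<in> Chains (ideal_lattice r) \<longleftrightarrow> C \<subseteq> order_ideals r \<and> (\<forall>I\<in>C. \<forall>K\<in>C. I \<subseteq> K \<or> K \<subseteq> I)"
  by (auto simp: Chains_def ideal_lattice_def relation_of_def)

lemma order_ideal_remove_maximal:
  assumes "Partial_order r" "finite (Field r)" "I \<in> order_ideals r" "I \<noteq> {}"
  obtains x where "x \<in> I" "I - {x} \<in> order_ideals r"
proof -
  have I: "finite I" "I \<subseteq> Field r"
    using assms finite_subset by (auto simp: order_ideals_def)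
  have po: "trans r" "antisym r"
    using assms by (auto simp: partial_order_on_def preorder_on_def)
  have "finite r"
    using assms(2) by (metis finite_cartesian_product finite_subset FieldI1 FieldI2 mem_Sigma_iff subrelI)
  moreover have "acyclic (r - Id)"
    using po by (simp add: acyclic_irrefl trans_diff_Id irrefl_def)
  ultimately have "wf ((r - Id)\<inverse>)"
    by (simp add: finite_acyclic_wf_converse)
  then obtain x where x: "x \<in> I" "\<And>y. (y, x) \<in> (r - Id)\<inverse> \<Longrightarrow> y \<notin> I"
    using assms(4) by (metis wfE_min ex_in_conv)
  then have "I - {x} \<in> order_ideals r"
    using assms(3) by (auto simp: order_ideals_def)
  with x(1) show ?thesis by (rule that)
qed

lemma saturated_chain_ideal_lattice:
  assumes "Partial_order r" "finite (Field r)" "I \<in> order_ideals r"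
  shows "\<exists>C \<in> Chains (ideal_lattice r). (\<forall>K\<in>C. K \<subseteq> I) \<and> finite C \<and> card C = Suc (card I)"
  using assms(3)
proof (induction "card I" arbitrary: I)
  case 0
  then have "I = {}"
    using assms(2) finite_subset by (fastforce simp: order_ideals_def)
  then show ?case
    using 0 by (intro bexI[of _ "{{}}"]) (auto simp: Chains_ideal_lattice_iff)
next
  case (Suc k)
  then obtain x where x: "x \<in> I" "I - {x} \<in> order_ideals r"
    using order_ideal_remove_maximal[OF assms(1,2)] by (metis card.empty nat.distinct(1))
  have "card (I - {x}) = k"
    using Suc.hyps(2) x(1) by simp
  then obtain C where C: "C \<in> Chains (ideal_lattice r)" "\<forall>K\<in>C. K \<subseteq> I - {x}" "finite C" "card C = Suc k"
    using Suc.hyps(1)[OF _ x(2)] by metis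
  have "I \<notin> C" using C(2) x(1) by blast
  then show ?case
    using C Suc.hyps(2) Suc.prems
    by (intro bexI[of _ "insert I C"]) (auto simp: Chains_ideal_lattice_iff)
qed

lemma card_chain_ideal_lattice_le:
  assumes "finite (Field r)" "C \<in> Chains (ideal_lattice r)" "\<forall>K\<in>C. K \<subseteq> I" "I \<subseteq> Field r"
  shows "card C \<le> Suc (card I)"
proof -
  have fin: "finite I" using assms finite_subset by blast
  have "inj_on card C"
  proof (rule inj_onI)
    fix K L assume "K \<in> C" "L \<in> C" "card K = card L"
    moreover from this have "finite K" "finite L"
      using assms(3) fin finite_subset[of K I] finite_subset[of L I] by simp_all
    moreover have "K \<subseteq> L \<or> L \<subseteq> K"
      using assms(2) \<open>K \<in> C\<close> \<open>L \<in> C\<close> unfolding Chains_ideal_lattice_iff by blast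
    ultimately show "K = L" by (metis card_subset_eq)
  qed
  moreover have "card ` C \<subseteq> {..card I}"
    using assms(3) card_mono[OF fin] by blast
  ultimately have "card C \<le> card {..card I}"
    by (metis card_inj_on_le finite_atMost)
  then show ?thesis by simp
qed

lemma elem_rank_ideal_lattice:
  assumes "Partial_order r" "finite (Field r)" "I \<in> order_ideals r"
  shows "elem_rank (ideal_lattice r) I = card I"
proof -
  have I: "I \<subseteq> Field r" using assms(3) by (simp add: order_ideals_def)
  have under: "C \<subseteq> under (ideal_lattice r) I \<longleftrightarrow> (\<forall>K\<in>C. K \<subseteq> I)" if "C \<in> Chains (ideal_lattice r)" for C
    using that assms(3) unfolding Chains_ideal_lattice_iff by (auto simp: under_def ideal_lattice_def relation_of_def)
  obtain C where C: "C \<in> Chains (ideal_lattice r)" "\<forall>K\<in>C. K \<subseteq> I" "card C = Suc (card I)"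
    using saturated_chain_ideal_lattice[OF assms] by blast
  let ?X = "{card C - 1 |C. C \<in> Chains (ideal_lattice r) \<and> C \<subseteq> under (ideal_lattice r) I}"
  have le: "m \<le> card I" if "m \<in> ?X" for m
  proof -
    from that obtain D where D: "m = card D - 1" "D \<in> Chains (ideal_lattice r)"
      "D \<subseteq> under (ideal_lattice r) I" by blast
    have "\<forall>K\<in>D. K \<subseteq> I" using under[OF D(2)] D(3) by simp
    from card_chain_ideal_lattice_le[OF assms(2) D(2) this I] D(1) show ?thesis by simp
  qed
  then have "finite ?X" by (meson finite_nat_set_iff_bounded_le)
  moreover have "card I \<in> ?X"
  proof -
    have "C \<subseteq> under (ideal_lattice r) I" using under[OF C(1)] C(2) by simp
    moreover have "card I = card C - 1" using C(3) by simp
    ultimately show ?thesis using C(1) by blast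
  qed
  ultimately show ?thesis unfolding elem_rank_def by (intro Max_eqI le)
qed

lemma poset_rank_ideal_lattice:
  assumes "Partial_order r" "finite (Field r)"
  shows "poset_rank (ideal_lattice r) = card (Field r)"
proof -
  have top: "Field r \<in> order_ideals r" by (auto simp: order_ideals_def FieldI1)
  have "C \<subseteq> under (ideal_lattice r) (Field r)" if "C \<in> Chains (ideal_lattice r)" for C
  proof -
    have "C \<subseteq> order_ideals r" using that by (simp add: Chains_ideal_lattice_iff)
    moreover have "K \<subseteq> Field r" if "K \<in> order_ideals r" for K
      using that by (simp add: order_ideals_def)
    ultimately show ?thesis
      using top by (auto simp: under_def ideal_lattice_def relation_of_def)
  qed
  then have "poset_rank (ideal_lattice r) = elem_rank (ideal_lattice r) (Field r)"
    unfolding poset_rank_def elem_rank_def by (intro arg_cong[where f = Max]) blast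
  then show ?thesis using elem_rank_ideal_lattice[OF assms top] by simp
qed

end

theory Submission
  imports Defs
begin

text \<open>
  Under (c), two distinct order ideals of the same size differ by exchanging one element, because
  their two differences are mutually incomparable chains that cannot both contain two elements.
  This gives (b), and it also evaluates the flag \<open>h\<close>-vector: adding a new largest rank \<open>s\<close> to \<open>S\<close>
  replaces \<open>\<beta>(S)\<close> of the interval below \<open>x\<close> by the sum over the (at most two) ideals \<open>y \<subseteq> x\<close> of size
  \<open>s\<close> of \<open>\<beta>(S)\<close> below \<open>y\<close>, minus \<open>\<beta>(S)\<close> below \<open>x\<close>, and all but one of these terms cancel.

  For the enumeration, every nonempty poset satisfying (c) has a maximal element lying above all
  other elements with at most one exception. Removing it repeatedly encodes the poset by a
  word, which becomes unique once the symmetry between two interchangeable maximal elements is broken.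
\<close>

section \<open>Order ideals of finite posets\<close>

text \<open>The recursion for the flag h-vector involves intervals below arbitrary ideals, and a
  mere bound on the values there would not survive a difference of sums. What survives is an exact
  formula: for each \<open>S\<close> there is a constant \<open>c\<close>, either 0 or 1, such that
  beta(\<open>S\<close>) below \<open>x\<close> equals \<open>c\<close> if \<open>x\<close> contains
  every ideal of size \<open>Max S\<close>, and 0 otherwise. So the value -1, which (a) permits,
  never occurs. From (a) to (b) singletons suffice, and from (b) to (c) a forbidden pattern together
  with the elements below it yields three ideals of one size. In the enumeration, the ways to
  continue a word depend on the shape of its maximal elements. Only a pair of non-interchangeable
  maximal elements offers two essentially different choices of the one to skip; this doubling gives
  the powers of two in g. Eliminating the number of such words from two consecutive counts gives
  f(n+3) = 3f(n+2) - f(n+1) - f(n), which is the denominator 1 - 3x + x^2 + x^3.\<close>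

locale finite_poset =
  fixes r :: "'a rel"
  assumes partial_order: "Partial_order r" and finite_Field: "finite (Field r)"
begin

lemma reflD: "x \<in> Field r \<Longrightarrow> (x, x) \<in> r"
  using partial_order by (auto simp: partial_order_on_def preorder_on_def refl_on_def)

lemma transD: "(x, y) \<in> r \<Longrightarrow> (y, z) \<in> r \<Longrightarrow> (x, z) \<in> r"
  using partial_order by (auto simp: partial_order_on_def preorder_on_def dest: transD)

lemma antisymD: "(x, y) \<in> r \<Longrightarrow> (y, x) \<in> r \<Longrightarrow> x = y"
  using partial_order by (auto simp: partial_order_on_def dest: antisymD)

lemma exists_minimal:
  assumes "A \<subseteq> Field r" "A \<noteq> {}"
  obtains x where "x \<in> A" "\<And>y. y \<in> A \<Longrightarrow> (y, x) \<in> r \<Longrightarrow> y = x"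
proof -
  obtain a where "a \<in> A" using assms by blast
  \<comment> \<open>A strictly smaller element has a strictly smaller principal ideal, so an element
    of \<open>A\<close> with the smallest principal ideal is minimal.\<close>
  then obtain x where x: "x \<in> A" "\<And>y. y \<in> A \<Longrightarrow> card (under r x) \<le> card (under r y)"
    using ex_has_least_nat[of "\<lambda>x. x \<in> A" a "\<lambda>x. card (under r x)"] by blast
  have "y = x" if y: "y \<in> A" "(y, x) \<in> r" for y
  proof (rule ccontr)
    assume "y \<noteq> x"
    then have "under r y \<subset> under r x"
      using y x(1) assms(1) antisymD reflD transD unfolding under_def by blast
    moreover have "finite (under r x)"
      using finite_Field by (rule finite_subset[rotated]) (auto simp: under_def FieldI1)
    ultimately have "card (under r y) < card (under r x)" by (simp add: psubset_card_mono)
    then show False using x(2)[OF y(1)] by simp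
  qed
  with x(1) show ?thesis using that by blast
qed

lemma exists_cover:
  assumes "(a, b) \<in> r" "a \<noteq> b"
  obtains x where "(a, x) \<in> r" "a \<noteq> x" "(x, b) \<in> r"
    "\<And>y. (a, y) \<in> r \<Longrightarrow> (y, x) \<in> r \<Longrightarrow> y = a \<or> y = x"
proof -
  let ?A = "{y. (a, y) \<in> r \<and> a \<noteq> y \<and> (y, b) \<in> r}"
  have "b \<in> ?A" using assms reflD by (auto simp: FieldI2)
  moreover have "?A \<subseteq> Field r" by (auto simp: FieldI1)
  ultimately obtain x where x: "x \<in> ?A" "\<And>y. y \<in> ?A \<Longrightarrow> (y, x) \<in> r \<Longrightarrow> y = x"
    using exists_minimal[of ?A] by blast
  have "y = a \<or> y = x" if "(a, y) \<in> r" "(y, x) \<in> r" for y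
    using x(1) x(2)[of y] that transD[OF that(2), of b] by auto
  with x(1) show ?thesis using that by blast
qed

lemma exists_maximal_above:
  assumes "a \<in> Field r"
  obtains x where "(a, x) \<in> r" "\<And>y. (x, y) \<in> r \<Longrightarrow> y = x"
proof -
  have cv: "finite_poset (r\<inverse>)"
    using partial_order finite_Field by (simp add: finite_poset_def)
  have "{x. (a, x) \<in> r} \<subseteq> Field (r\<inverse>)" "{x. (a, x) \<in> r} \<noteq> {}"
    using reflD[OF assms] by (auto simp: FieldI2)
  then obtain x where "(a, x) \<in> r" "\<And>y. (a, y) \<in> r \<Longrightarrow> (x, y) \<in> r \<Longrightarrow> y = x"
    using finite_poset.exists_minimal[OF cv] by (metis converse_iff mem_Collect_eq)
  then show ?thesis using that transD by blast
qed

section \<open>Ranks in the ideal lattice\<close>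

definition level :: "nat \<Rightarrow> 'a set set" where
  "level i = {I \<in> order_ideals r. card I = i}"

lemma order_ideal_subset: "I \<in> order_ideals r \<Longrightarrow> I \<subseteq> Field r"
  by (simp add: order_ideals_def)

lemma order_ideal_finite: "I \<in> order_ideals r \<Longrightarrow> finite I"
  using order_ideal_subset finite_Field finite_subset by blast

lemma order_ideal_down: "I \<in> order_ideals r \<Longrightarrow> t \<in> I \<Longrightarrow> (s, t) \<in> r \<Longrightarrow> s \<in> I"
  by (auto simp: order_ideals_def)

lemma order_ideal_Un: "I \<in> order_ideals r \<Longrightarrow> K \<in> order_ideals r \<Longrightarrow> I \<union> K \<in> order_ideals r"
  by (auto simp: order_ideals_def)

lemma order_ideal_empty: "{} \<in> order_ideals r"
  by (auto simp: order_ideals_def)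

lemma order_ideal_Field: "Field r \<in> order_ideals r"
  by (auto simp: order_ideals_def FieldI1)

lemma order_ideal_under: "under r x \<in> order_ideals r"
  using transD by (auto simp: order_ideals_def under_def FieldI1)

lemma finite_order_ideals: "finite (order_ideals r)"
  by (rule finite_subset[of _ "Pow (Field r)"]) (auto simp: order_ideals_def finite_Field)

lemma finite_level: "finite (level i)"
  using finite_order_ideals by (simp add: level_def)

text \<open>Adding a minimal element of \<open>K - I\<close> to \<open>I\<close> gives an ideal
  again, so \<open>I\<close> can be enlarged inside \<open>K\<close> one element at a time.\<close>

lemma order_ideal_between:
  assumes "I \<in> order_ideals r" "K \<in> order_ideals r" "I \<subseteq> K" "card I \<le> j" "j \<le> card K"
  obtains L where "L \<in> level j" "I \<subseteq> L" "L \<subseteq> K"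
proof -
  have "\<exists>L\<in>level j. I \<subseteq> L \<and> L \<subseteq> K"
    using assms
  proof (induction "j - card I" arbitrary: I)
    case 0
    then show ?case by (auto simp: level_def)
  next
    case (Suc d)
    have fin: "finite I" "finite K"
      using Suc.prems order_ideal_finite by auto
    have "I \<noteq> K" using Suc.hyps(2) Suc.prems by auto
    then obtain x where x: "x \<in> K - I" "\<And>y. y \<in> K - I \<Longrightarrow> (y, x) \<in> r \<Longrightarrow> y = x"
      using exists_minimal[of "K - I"] Suc.prems order_ideal_subset by blast
    have "insert x I \<in> order_ideals r"
      using x Suc.prems(1,2) unfolding order_ideals_def by blast
    moreover have "card (insert x I) = Suc (card I)"
      using fin x by simp
    ultimately have "\<exists>L\<in>level j. insert x I \<subseteq> L \<and> L \<subseteq> K"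
      using Suc.hyps(2) Suc.prems x(1) by (intro Suc.hyps(1)) auto
    then show ?case by blast
  qed
  then show ?thesis using that by blast
qed

lemma level_nonempty: "i \<le> card (Field r) \<Longrightarrow> level i \<noteq> {}"
  using order_ideal_between[OF order_ideal_empty order_ideal_Field, of i] by auto

lemma level_0: "level 0 = {{}}"
  using order_ideal_empty order_ideal_finite by (auto simp: level_def)

lemma level_top: "level (card (Field r)) = {Field r}"
  using order_ideal_Field card_subset_eq[OF finite_Field order_ideal_subset]
  by (auto simp: level_def)

lemma level_beyond: "card (Field r) < i \<Longrightarrow> level i = {}"
  using card_mono[OF finite_Field order_ideal_subset] by (force simp: level_def)

lemma rank_set_eq_level:
  "{I \<in> Field (ideal_lattice r). elem_rank (ideal_lattice r) I = i} = level i"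
  using elem_rank_ideal_lattice[OF partial_order finite_Field]
  by (auto simp: Field_ideal_lattice level_def)

lemma cond_b_iff: "cond_b r \<longleftrightarrow> (\<forall>i. card (level i) \<le> 2)"
  unfolding cond_b_def rank_set_eq_level
  by (metis atLeastAtMost_iff card.empty le0 level_beyond not_le)

end

section \<open>Isomorphism and the forbidden subposets\<close>

lemma poset_iso_sym: "poset_iso r s \<Longrightarrow> poset_iso s r"
proof -
  assume "poset_iso r s"
  then obtain f where f: "bij_betw f (Field r) (Field s)"
    "\<forall>x\<in>Field r. \<forall>y\<in>Field r. (x, y) \<in> r \<longleftrightarrow> (f x, f y) \<in> s"
    by (auto simp: poset_iso_def)
  let ?g = "inv_into (Field r) f"
  have g: "bij_betw ?g (Field s) (Field r)" using f(1) by (rule bij_betw_inv_into)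
  have "(x, y) \<in> s \<longleftrightarrow> (?g x, ?g y) \<in> r" if "x \<in> Field s" "y \<in> Field s" for x y
    using f(2) that bij_betw_apply[OF g] by (simp add: bij_betw_inv_into_right[OF f(1)])
  with g show ?thesis unfolding poset_iso_def by blast
qed

lemma poset_iso_trans: "poset_iso r s \<Longrightarrow> poset_iso s t \<Longrightarrow> poset_iso r t"
proof -
  assume "poset_iso r s" "poset_iso s t"
  then obtain f g where f: "bij_betw f (Field r) (Field s)"
    "\<forall>x\<in>Field r. \<forall>y\<in>Field r. (x, y) \<in> r \<longleftrightarrow> (f x, f y) \<in> s"
    and g: "bij_betw g (Field s) (Field t)"
    "\<forall>x\<in>Field s. \<forall>y\<in>Field s. (x, y) \<in> s \<longleftrightarrow> (g x, g y) \<in> t"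
    by (auto simp: poset_iso_def)
  have "bij_betw (g \<circ> f) (Field r) (Field t)" using f(1) g(1) by (rule bij_betw_trans)
  moreover have "(x, y) \<in> r \<longleftrightarrow> ((g \<circ> f) x, (g \<circ> f) y) \<in> t" if "x \<in> Field r" "y \<in> Field r" for x y
    using f g that by (simp add: bij_betw_apply)
  ultimately show ?thesis unfolding poset_iso_def by blast
qed

lemma poset_iso_refl: "poset_iso r r"
  unfolding poset_iso_def by (rule exI[of _ id]) auto

lemma two_plus_two_elements:
  "disjoint_sum (chain_poset 2) (chain_poset 2) =
    {(Inl 0, Inl 0), (Inl 0, Inl 1), (Inl 1, Inl 1), (Inr 0, Inr 0), (Inr 0, Inr 1), (Inr 1, Inr 1)}"
proof -
  have "chain_poset 2 = {(0, 0), (0, 1), (1, 1)}"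
    by (auto simp: chain_poset_def relation_of_def less_Suc_eq numeral_2_eq_2)
  then show ?thesis by (auto simp: disjoint_sum_def)
qed

lemma Field_two_plus_two:
  "Field (disjoint_sum (chain_poset 2) (chain_poset 2)) = {Inl 0, Inl 1, Inr 0, Inr 1}"
  unfolding two_plus_two_elements by (auto simp: Field_def)

context finite_poset
begin

text \<open>Only two comparabilities have to be named: by transitivity, any other relation between
  the two chains implies one of them. This form also passes to induced subposets at once.\<close>

lemma two_plus_two_free_iff:
  "two_plus_two_free r \<longleftrightarrow>
    (\<forall>a b c d. (a, b) \<in> r \<longrightarrow> a \<noteq> b \<longrightarrow> (c, d) \<in> r \<longrightarrow> c \<noteq> d \<longrightarrow> (a, d) \<in> r \<or> (c, b) \<in> r)"
  (is "?L \<longleftrightarrow> ?R")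
proof
  assume L: ?L
  show ?R
  proof (intro allI impI, rule ccontr)
    fix a b c d
    assume *: "(a, b) \<in> r" "a \<noteq> b" "(c, d) \<in> r" "c \<noteq> d" and "\<not> ((a, d) \<in> r \<or> (c, b) \<in> r)"
    then have n: "(a, d) \<notin> r" "(c, b) \<notin> r" by auto
    have F: "a \<in> Field r" "b \<in> Field r" "c \<in> Field r" "d \<in> Field r"
      using * by (auto simp: FieldI1 FieldI2)
    have nn: "(a, c) \<notin> r" "(c, a) \<notin> r" "(b, d) \<notin> r" "(d, b) \<notin> r" "(b, c) \<notin> r" "(d, a) \<notin> r"
      "(b, a) \<notin> r" "(d, c) \<notin> r"
      using * n transD antisymD by blast+
    have d: "a \<noteq> c" "a \<noteq> d" "b \<noteq> c" "b \<noteq> d" using n nn F[THEN reflD] by auto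
    let ?A = "{a, b, c, d}"
    have FA: "Field (Restr r ?A) = ?A" using F[THEN reflD] by (auto simp: Field_def)
    define f :: "'a \<Rightarrow> nat + nat" where
      "f = (\<lambda>x. if x = a then Inl 0 else if x = b then Inl 1 else if x = c then Inr 0 else Inr 1)"
    have "poset_iso (Restr r ?A) (disjoint_sum (chain_poset 2) (chain_poset 2))"
      unfolding poset_iso_def FA Field_two_plus_two
    proof (intro exI[of _ f] conjI ballI)
      show "bij_betw f ?A {Inl 0, Inl 1, Inr 0, Inr 1}"
        using * d by (auto simp: bij_betw_def inj_on_def f_def)
      show "(x, y) \<in> Restr r ?A \<longleftrightarrow> (f x, f y) \<in> disjoint_sum (chain_poset 2) (chain_poset 2)"
        if "x \<in> ?A" "y \<in> ?A" for x y
        using that(1)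
      proof (elim insertE emptyE)
      qed (use that(2) * d n nn F[THEN reflD] in \<open>auto simp: two_plus_two_elements f_def\<close>)
    qed
    moreover have "?A \<subseteq> Field r" using F by blast
    ultimately show False using L unfolding two_plus_two_free_def by blast
  qed
next
  assume R: ?R
  show ?L unfolding two_plus_two_free_def
  proof (rule notI, elim exE conjE)
    fix A assume A: "A \<subseteq> Field r"
      and iso: "poset_iso (Restr r A) (disjoint_sum (chain_poset 2) (chain_poset 2))"
    obtain g where g: "bij_betw g {Inl 0, Inl 1, Inr 0, Inr 1} (Field (Restr r A))"
      "\<forall>x\<in>{Inl 0, Inl 1, Inr 0, Inr 1}. \<forall>y\<in>{Inl 0, Inl 1, Inr 0, Inr 1}.
        (x, y) \<in> disjoint_sum (chain_poset 2) (chain_poset 2) \<longleftrightarrow> (g x, g y) \<in> Restr r A"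
      using poset_iso_sym[OF iso] unfolding poset_iso_def Field_two_plus_two by blast
    have "g x \<in> A" if "x \<in> {Inl 0, Inl 1, Inr 0, Inr 1}" for x
      using bij_betw_apply[OF g(1) that] by (auto simp: Field_def)
    then have g2: "\<forall>x\<in>{Inl 0, Inl 1, Inr 0, Inr 1}. \<forall>y\<in>{Inl 0, Inl 1, Inr 0, Inr 1}.
        (x, y) \<in> disjoint_sum (chain_poset 2) (chain_poset 2) \<longleftrightarrow> (g x, g y) \<in> r"
      using g(2) by blast
    have "g (Inl 0) \<noteq> g (Inl 1)" "g (Inr 0) \<noteq> g (Inr 1)"
      using g(1) by (auto simp: bij_betw_def inj_on_def)
    then show False
      using R[rule_format, of "g (Inl 0)" "g (Inl 1)" "g (Inr 0)" "g (Inr 1)"] g2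
      unfolding two_plus_two_elements by auto
  qed
qed

lemma one_plus_one_plus_one_free_iff:
  "one_plus_one_plus_one_free r \<longleftrightarrow>
    \<not> (\<exists>a b c. antichain r {a, b, c} \<and> a \<noteq> b \<and> a \<noteq> c \<and> b \<noteq> c)"
  unfolding one_plus_one_plus_one_free_def card_3_iff by blast

section \<open>Equivalence of (b) and (c)\<close>

lemma incomparable_Diff:
  assumes "X \<in> order_ideals r" "Y \<in> order_ideals r" "x \<in> X - Y" "y \<in> Y - X"
  shows "(x, y) \<notin> r" "(y, x) \<notin> r"
  using assms order_ideal_down by blast+

lemma exchange:
  assumes c: "cond_c r" and X: "X \<in> level i" "Y \<in> level i" "X \<noteq> Y"
  obtains x y where "X - Y = {x}" "Y - X = {y}"
proof -
  have I: "X \<in> order_ideals r" "Y \<in> order_ideals r" "card X = i" "card Y = i"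
    using X by (auto simp: level_def)
  note fin = I(1,2)[THEN order_ideal_finite]
  have eq: "card (X - Y) = card (Y - X)"
    using I(3,4) fin by (metis card_le_sym_Diff le_antisym order_refl)
  have ne: "X - Y \<noteq> {}" "Y - X \<noteq> {}"
    using X(3) I(3,4) fin card_subset_eq[of Y X] card_subset_eq[of X Y] by auto
  \<comment> \<open>Two incomparable elements of one difference, together with any element of the
    other, would be an antichain of three.\<close>
  have chain: "(p, q) \<in> r \<or> (q, p) \<in> r"
    if K: "K \<in> order_ideals r" "L \<in> order_ideals r" "L - K \<noteq> {}" "p \<in> K - L" "q \<in> K - L" for K L p q
  proof (rule ccontr)
    assume n: "\<not> ((p, q) \<in> r \<or> (q, p) \<in> r)"
    obtain z where z: "z \<in> L - K" using K(3) by blast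
    have F: "p \<in> Field r" "q \<in> Field r" "z \<in> Field r" using K(1,2,4,5) z order_ideal_subset by auto
    then have "p \<noteq> q" using n F(1)[THEN reflD] by auto
    moreover have "antichain r {p, q, z}"
      using F n incomparable_Diff[OF K(1,2,4) z] incomparable_Diff[OF K(1,2,5) z]
      unfolding antichain_def by auto
    ultimately show False
      using c K(4,5) z unfolding cond_c_def one_plus_one_plus_one_free_iff by blast
  qed
  have "card (X - Y) = 1"
  proof (rule ccontr)
    assume "card (X - Y) \<noteq> 1"
    then have "\<not> is_singleton (X - Y)" "\<not> is_singleton (Y - X)"
      using eq by (auto simp: is_singleton_altdef)
    then obtain a b c d where abcd: "a \<in> X - Y" "b \<in> X - Y" "a \<noteq> b" "c \<in> Y - X" "d \<in> Y - X" "c \<noteq> d"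
      using ne by (metis is_singletonI' )
    obtain a' b' where ab: "a' \<in> X - Y" "b' \<in> X - Y" "a' \<noteq> b'" "(a', b') \<in> r"
      using chain[OF I(1,2) ne(2) abcd(1,2)] abcd by blast
    obtain c' d' where cd: "c' \<in> Y - X" "d' \<in> Y - X" "c' \<noteq> d'" "(c', d') \<in> r"
      using chain[OF I(2,1) ne(1) abcd(4,5)] abcd by blast
    have "(a', d') \<in> r \<or> (c', b') \<in> r"
      using c ab cd unfolding cond_c_def two_plus_two_free_iff by blast
    then show False
      using incomparable_Diff[OF I(1,2) ab(1) cd(2)] incomparable_Diff[OF I(1,2) ab(2) cd(1)] by blast
  qed
  then show ?thesis using eq that by (metis card_1_singletonE)
qed

lemma cond_c_imp_cond_b:
  assumes "cond_c r"
  shows "cond_b r"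
  unfolding cond_b_iff
proof (rule allI, rule ccontr)
  fix i
  assume "\<not> card (level i) \<le> 2"
  then have "3 \<le> card (level i)" by simp
  then obtain T where "T \<subseteq> level i" "card T = 3" by (meson obtain_subset_with_card_n)
  then obtain X Y Z where T: "X \<in> level i" "Y \<in> level i" "Z \<in> level i" "X \<noteq> Y" "X \<noteq> Z" "Y \<noteq> Z"
    by (auto simp: card_3_iff)
  have I: "X \<in> order_ideals r" "Y \<in> order_ideals r" "Z \<in> order_ideals r"
    using T by (auto simp: level_def)
  obtain a b where ab: "X - Y = {a}" "Y - X = {b}" using exchange[OF assms T(1,2,4)] .
  obtain a' c where ac: "X - Z = {a'}" "Z - X = {c}" using exchange[OF assms T(1,3,5)] .
  obtain b' c' where bc: "Y - Z = {b'}" "Z - Y = {c'}" using exchange[OF assms T(2,3,6)] .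
  have ab': "a \<in> X" "a \<notin> Y" "b \<in> Y" "b \<notin> X"
    and abu: "\<And>t. t \<in> X \<Longrightarrow> t \<notin> Y \<Longrightarrow> t = a" "\<And>t. t \<in> Y \<Longrightarrow> t \<notin> X \<Longrightarrow> t = b"
    using ab by auto
  have ac': "a' \<in> X" "a' \<notin> Z" "c \<in> Z" "c \<notin> X"
    and acu: "\<And>t. t \<in> X \<Longrightarrow> t \<notin> Z \<Longrightarrow> t = a'" "\<And>t. t \<in> Z \<Longrightarrow> t \<notin> X \<Longrightarrow> t = c"
    using ac by auto
  have bcu: "\<And>t. t \<in> Z \<Longrightarrow> t \<notin> Y \<Longrightarrow> t = c'"
    using bc by auto
  \<comment> \<open>Either \<open>Z\<close> shares \<open>X \<inter> Y\<close>, and then \<open>a\<close>, \<open>b\<close> and the new element \<open>c\<close> form an antichain,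
    or \<open>Z\<close> contains both \<open>a\<close> and \<open>b\<close>, and then \<open>a\<close>, \<open>b\<close> and the missing element do.\<close>
  have "\<exists>m. antichain r {a, b, m} \<and> a \<noteq> m \<and> b \<noteq> m"
  proof (cases "c = b")
    case True
    \<comment> \<open>If also \<open>a = a'\<close>, then \<open>Y\<close> and \<open>Z\<close> both
      arise from \<open>X\<close> by trading \<open>a\<close> for \<open>b\<close>.\<close>
    have a': "a \<noteq> a'"
    proof
      assume "a = a'"
      then have "Y = Z" using True ab' ac' abu acu by blast
      then show False using T(6) by simp
    qed
    have "a' \<in> Y" using a' abu(1) ac'(1) by metis
    moreover have "a \<in> Z" using a' acu(1) ab'(1) by metis
    ultimately have mem: "a' \<in> X - Z" "a' \<in> Y - Z" "a \<in> Z - Y" "b \<in> Y - X" "b \<in> Z - X" "a \<in> X - Y"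
      using True ab' ac' by auto
    then have "antichain r {a, b, a'}"
      using I[THEN order_ideal_subset] incomparable_Diff[OF I(1,2) mem(6,4)]
        incomparable_Diff[OF I(1,3) mem(1,5)] incomparable_Diff[OF I(2,3) mem(2,3)]
      unfolding antichain_def by auto
    then show ?thesis using a' mem by blast
  next
    case False
    have b: "b \<in> Y - X" "b \<notin> Z" using False ab' acu(2) by auto
    have c: "c \<in> Z - X" "c \<notin> Y" using False ac' abu(2) by auto
    have a: "a \<in> X - Y" using ab' by simp
    have "a \<notin> Z" using a c bcu by blast
    then have mem: "a \<in> X - Z" "b \<in> Y - Z" "c \<in> Z - Y" using a b c by auto
    then have "antichain r {a, b, c}"
      using I[THEN order_ideal_subset] incomparable_Diff[OF I(1,2) a b(1)]
        incomparable_Diff[OF I(1,3) mem(1) c(1)] incomparable_Diff[OF I(2,3) mem(2,3)]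
      unfolding antichain_def by auto
    then show ?thesis using mem by blast
  qed
  moreover have "a \<noteq> b" using ab by blast
  ultimately show False
    using assms unfolding cond_c_def one_plus_one_plus_one_free_iff by blast
qed

lemma three_ideals_not_cond_b:
  assumes "X \<in> level i" "Y \<in> level i" "Z \<in> level i" "X \<noteq> Y" "X \<noteq> Z" "Y \<noteq> Z"
  shows "\<not> cond_b r"
proof -
  have "card {X, Y, Z} \<le> card (level i)"
    using assms by (intro card_mono finite_level) auto
  moreover have "card {X, Y, Z} = 3" using assms by simp
  ultimately have "\<not> card (level i) \<le> 2" by simp
  then show ?thesis unfolding cond_b_iff by blast
qed

text \<open>Let \<open>D\<close> consist of the elements below a forbidden pattern, without the
  pattern itself. For an antichain, adding any one of its three elements to \<open>D\<close> gives
  an ideal; for two chains, one can add either chain or the two bottom elements. Each time three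
  ideals of equal size arise.\<close>

lemma cond_b_imp_cond_c:
  assumes b: "cond_b r"
  shows "cond_c r"
proof -
  have "one_plus_one_plus_one_free r"
    unfolding one_plus_one_plus_one_free_iff
  proof safe
    fix a b c assume A: "antichain r {a, b, c}" "a \<noteq> b" "a \<noteq> c" "b \<noteq> c"
    define D where "D = {z. \<exists>t\<in>{a, b, c}. (z, t) \<in> r \<and> z \<noteq> t}"
    have D: "D \<subseteq> Field r" "a \<notin> D" "b \<notin> D" "c \<notin> D"
      using A unfolding D_def antichain_def by (auto simp: FieldI1)
    have "s \<in> D" if "t \<in> D" "(s, t) \<in> r" for s t
    proof -
      obtain u where u: "u \<in> {a, b, c}" "(t, u) \<in> r" "t \<noteq> u" using \<open>t \<in> D\<close> unfolding D_def by blast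
      then have "(s, u) \<in> r" "s \<noteq> u" using that(2) transD antisymD by blast+
      with u(1) show ?thesis unfolding D_def by blast
    qed
    moreover have "s \<in> insert t D" if "t \<in> {a, b, c}" "(s, t) \<in> r" for s t
      using that unfolding D_def by blast
    moreover have "{a, b, c} \<subseteq> Field r" using A(1) by (simp add: antichain_def)
    ultimately have "insert t D \<in> order_ideals r" if "t \<in> {a, b, c}" for t
      using that D(1) unfolding order_ideals_def by blast
    moreover have "finite D" using D(1) finite_Field finite_subset by blast
    ultimately have "insert a D \<in> level (Suc (card D))" "insert b D \<in> level (Suc (card D))"
      "insert c D \<in> level (Suc (card D))"
      using D by (auto simp: level_def)
    moreover have "insert a D \<noteq> insert b D" "insert a D \<noteq> insert c D" "insert b D \<noteq> insert c D"
      using A D by blast+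
    ultimately show False using three_ideals_not_cond_b b by blast
  qed
  moreover have "two_plus_two_free r"
    unfolding two_plus_two_free_iff
  proof (intro allI impI, rule ccontr)
    fix a b0 c d0
    assume *: "(a, b0) \<in> r" "a \<noteq> b0" "(c, d0) \<in> r" "c \<noteq> d0" "\<not> ((a, d0) \<in> r \<or> (c, b0) \<in> r)"
    \<comment> \<open>The tops are replaced by covers of the bottoms: an element strictly between
      \<open>a\<close> and \<open>b\<close> would lie in \<open>D\<close> while \<open>a\<close>
      does not, so \<open>D\<close> would fail to be an ideal.\<close>
    obtain b where b1: "(a, b) \<in> r" "a \<noteq> b" "(b, b0) \<in> r"
      and bcov: "\<And>y. (a, y) \<in> r \<Longrightarrow> (y, b) \<in> r \<Longrightarrow> y = a \<or> y = b"
      using exists_cover[OF *(1,2)] by metis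
    obtain d where d1: "(c, d) \<in> r" "c \<noteq> d" "(d, d0) \<in> r"
      and dcov: "\<And>y. (c, y) \<in> r \<Longrightarrow> (y, d) \<in> r \<Longrightarrow> y = c \<or> y = d"
      using exists_cover[OF *(3,4)] by metis
    have n: "(a, d) \<notin> r" "(c, b) \<notin> r" using * b1 d1 transD by blast+
    have nn: "(a, c) \<notin> r" "(c, a) \<notin> r" "(b, d) \<notin> r" "(d, b) \<notin> r" "(b, c) \<notin> r" "(d, a) \<notin> r"
      "(b, a) \<notin> r" "(d, c) \<notin> r"
      using b1 d1 n transD antisymD by blast+
    have F: "a \<in> Field r" "b \<in> Field r" "c \<in> Field r" "d \<in> Field r"
      using b1 d1 by (auto simp: FieldI1 FieldI2)
    have dist: "a \<noteq> c" "a \<noteq> d" "b \<noteq> c" "b \<noteq> d" using n nn F[THEN reflD] by auto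
    define D where "D = {z. ((z, b) \<in> r \<or> (z, d) \<in> r) \<and> z \<notin> {a, b, c, d}}"
    have D: "D \<subseteq> Field r" "D \<inter> {a, b, c, d} = {}" by (auto simp: D_def FieldI1)
    have cl: "s \<in> D" if "t \<in> D" "(s, t) \<in> r" for s t
    proof -
      have t: "t \<notin> {a, b, c, d}" "(t, b) \<in> r \<or> (t, d) \<in> r" using \<open>t \<in> D\<close> unfolding D_def by auto
      then have s: "(s, b) \<in> r \<or> (s, d) \<in> r" using that(2) transD by blast
      have "s \<noteq> a"
      proof
        assume "s = a"
        then show False using t that(2) transD bcov n(1) by blast
      qed
      moreover have "s \<noteq> b"
      proof
        assume "s = b"
        then show False using t that(2) transD antisymD nn by blast
      qed
      moreover have "s \<noteq> c"
      proof
        assume "s = c"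
        then show False using t that(2) transD dcov n(2) by blast
      qed
      moreover have "s \<noteq> d"
      proof
        assume "s = d"
        then show False using t that(2) transD antisymD nn by blast
      qed
      ultimately show ?thesis using s by (simp add: D_def)
    qed
    have below: "s \<in> D \<union> {a, b}" if "(s, b) \<in> r" for s
      using that n nn unfolding D_def by blast
    have below': "s \<in> D \<union> {c, d}" if "(s, d) \<in> r" for s
      using that n nn unfolding D_def by blast
    have "s \<in> D \<union> {a}" if "(s, a) \<in> r" for s
      using that below[of s] transD[OF that b1(1)] nn by blast
    moreover have "s \<in> D \<union> {c}" if "(s, c) \<in> r" for s
      using that below'[of s] transD[OF that d1(1)] nn by blast
    ultimately have "D \<union> {a, b} \<in> order_ideals r" "D \<union> {c, d} \<in> order_ideals r"
      "D \<union> {a, c} \<in> order_ideals r"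
      using D(1) F cl below below' unfolding order_ideals_def by blast+
    moreover have "finite D" using D(1) finite_Field finite_subset by blast
    then have "card (D \<union> {a, b}) = card D + 2" "card (D \<union> {c, d}) = card D + 2" "card (D \<union> {a, c}) = card D + 2"
      using D(2) b1 d1 dist by (simp_all add: card_Un_disjoint)
    ultimately have "D \<union> {a, b} \<in> level (card D + 2)" "D \<union> {c, d} \<in> level (card D + 2)"
      "D \<union> {a, c} \<in> level (card D + 2)" by (auto simp: level_def)
    moreover have "D \<union> {a, b} \<noteq> D \<union> {c, d}" "D \<union> {a, b} \<noteq> D \<union> {a, c}" "D \<union> {c, d} \<noteq> D \<union> {a, c}"
      using D(2) dist b1(2) d1(2) by blast+
    ultimately show False using three_ideals_not_cond_b b by blast
  qed
  ultimately show ?thesis by (simp add: cond_c_def)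
qed

lemma cond_b_iff_cond_c: "cond_b r \<longleftrightarrow> cond_c r"
  using cond_b_imp_cond_c cond_c_imp_cond_b by blast


section \<open>Ordinal sums\<close>

text \<open>The lower part determines the decomposition: the summands are the restrictions of
  \<open>r\<close> to \<open>A\<close> and to its complement, and antisymmetry rules out relations
  from the complement into \<open>A\<close>.\<close>

lemma nontrivial_ordinal_sum_iff:
  "nontrivial_ordinal_sum r \<longleftrightarrow>
    (\<exists>A \<subseteq> Field r. A \<noteq> {} \<and> A \<noteq> Field r \<and> A \<times> (Field r - A) \<subseteq> r)" (is "?L \<longleftrightarrow> ?R")
proof
  assume ?L
  then obtain r1 r2 where *: "Field r1 \<noteq> {}" "Field r2 \<noteq> {}" "Field r1 \<inter> Field r2 = {}"
    "r = r1 \<union> r2 \<union> Field r1 \<times> Field r2"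
    unfolding nontrivial_ordinal_sum_def ordinal_sum_def by blast
  then have "Field r = Field r1 \<union> Field r2" unfolding Field_def by blast
  then show ?R using * by (intro exI[of _ "Field r1"]) auto
next
  assume ?R
  then obtain A where A: "A \<subseteq> Field r" "A \<noteq> {}" "A \<noteq> Field r" "A \<times> (Field r - A) \<subseteq> r" by blast
  have FR: "Field (Restr r B) = B" "Partial_order (Restr r B)" if "B \<subseteq> Field r" for B
  proof -
    have "Refl r" using partial_order by (simp add: partial_order_on_def preorder_on_def)
    then show "Field (Restr r B) = B" using that by (rule Refl_Field_Restr2)
    show "Partial_order (Restr r B)" using partial_order by (rule Partial_order_Restr)
  qed
  have "r = ordinal_sum (Restr r A) (Restr r (Field r - A))"
  proof -
    have "(x, y) \<notin> r" if "x \<in> Field r - A" "y \<in> A" for x y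
    proof
      assume "(x, y) \<in> r"
      moreover have "(y, x) \<in> r" using A(4) that by blast
      ultimately show False using antisymD that by blast
    qed
    moreover have "x \<in> Field r" "y \<in> Field r" if "(x, y) \<in> r" for x y
      using that by (auto simp: FieldI1 FieldI2)
    ultimately have "r = Restr r A \<union> Restr r (Field r - A) \<union> A \<times> (Field r - A)"
      using A(4) by (intro equalityI subrelI) blast+
    then show ?thesis
      unfolding ordinal_sum_def FR(1)[OF A(1)] FR(1)[OF Diff_subset] .
  qed
  then show ?L
    unfolding nontrivial_ordinal_sum_def
    using A(1-3) FR(2)[OF A(1)] FR(2)[OF Diff_subset]
    by (intro exI[of _ "Restr r A"] exI[of _ "Restr r (Field r - A)"] conjI;
        (simp only: FR(1)[OF A(1)] FR(1)[OF Diff_subset])?; blast)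
qed

text \<open>If \<open>A\<close> is the lower summand, an ideal with a point outside \<open>A\<close>
  contains all of \<open>A\<close> and is too large, so \<open>A\<close> is alone in its rank.
  Conversely, let \<open>I\<close> be alone in rank \<open>i\<close> and let \<open>y\<close> lie
  outside \<open>I\<close>. The principal ideal of \<open>y\<close> has at least \<open>i\<close>
  elements, since otherwise it would extend to a second ideal of size \<open>i\<close>; hence it
  contains an ideal of size \<open>i\<close>, which must be \<open>I\<close>.\<close>

lemma nontrivial_ordinal_sum_iff_level:
  "nontrivial_ordinal_sum r \<longleftrightarrow> (\<exists>i \<in> {1..card (Field r) - 1}. card (level i) = 1)"
  (is "?L \<longleftrightarrow> ?R")
proof
  assume ?L
  then obtain A where A: "A \<subseteq> Field r" "A \<noteq> {}" "A \<noteq> Field r" "A \<times> (Field r - A) \<subseteq> r"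
    unfolding nontrivial_ordinal_sum_iff by blast
  have fin: "finite A" using A(1) finite_Field finite_subset by blast
  have "K = A" if K: "K \<in> level (card A)" for K
  proof -
    have K': "K \<in> order_ideals r" "card K = card A" using K by (auto simp: level_def)
    have "K \<subseteq> A"
    proof (rule ccontr)
      assume "\<not> K \<subseteq> A"
      then obtain x where x: "x \<in> K" "x \<notin> A" by blast
      then have "x \<in> Field r" using K' order_ideal_subset by blast
      have "y \<in> K" if "y \<in> A" for y
        using order_ideal_down[OF K'(1) x(1), of y] A(4) that x(2) \<open>x \<in> Field r\<close> by auto
      then have "insert x A \<subseteq> K" using x by blast
      then have "card (insert x A) \<le> card K" by (intro card_mono order_ideal_finite K')
      then show False using fin x(2) K'(2) by simp
    qed
    then show ?thesis using card_subset_eq[OF fin _ K'(2)] by simp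
  qed
  moreover have "0 < card A" "card A < card (Field r)"
    using fin A psubset_card_mono[OF finite_Field, of A] by (auto simp: card_gt_0_iff)
  moreover from this have "level (card A) \<noteq> {}" by (intro level_nonempty) simp
  ultimately show ?R
    by (intro bexI[of _ "card A"]) (auto simp: card_1_singleton_iff)
next
  assume ?R
  then obtain i I where i: "1 \<le> i" "i \<le> card (Field r) - 1" "level i = {I}"
    by (auto simp: card_1_singleton_iff)
  then have I: "I \<in> order_ideals r" "card I = i" by (auto simp: level_def)
  have "(x, y) \<in> r" if x: "x \<in> I" and y: "y \<in> Field r - I" for x y
  proof -
    have yy: "y \<in> under r y" using y reflD by (auto simp: under_def)
    have "i \<le> card (under r y)"
    proof (rule ccontr)
      assume "\<not> i \<le> card (under r y)"
      then have *: "card (under r y) \<le> i" "i \<le> card (Field r)" using i(2) by simp_all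
      obtain L where "L \<in> level i" "under r y \<subseteq> L" "L \<subseteq> Field r"
        using order_ideal_between[OF order_ideal_under order_ideal_Field
          order_ideal_subset[OF order_ideal_under] *] .
      then show False using i(3) yy y by auto
    qed
    then obtain L where "L \<in> level i" "L \<subseteq> under r y"
      using order_ideal_between[OF order_ideal_empty order_ideal_under, of y i] by auto
    then show ?thesis using i(3) x by (auto simp: under_def)
  qed
  moreover have "I \<noteq> {}" "I \<noteq> Field r" using I(2) i(1,2) by auto
  ultimately show ?L
    unfolding nontrivial_ordinal_sum_iff using order_ideal_subset[OF I(1)] by blast
qed

section \<open>Flag vectors of intervals in the ideal lattice\<close>

text \<open>These chains give the flag numbers of the interval from the empty ideal to
  \<open>x\<close>, with cardinality as rank. The recursion on the largest rank moves from
  \<open>Field r\<close> to smaller ideals, so the upper end has to vary.\<close>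

definition chains_below :: "'a set \<Rightarrow> nat set \<Rightarrow> 'a set set set" where
  "chains_below x T = {C \<in> Chains (ideal_lattice r). (\<forall>I\<in>C. I \<subseteq> x) \<and> card ` C = T}"

definition flag_h_below :: "'a set \<Rightarrow> nat set \<Rightarrow> int" where
  "flag_h_below x S = (\<Sum>T\<in>Pow S. (- 1) ^ card (S - T) * int (card (chains_below x T)))"

lemma finite_chains_below: "finite (chains_below x T)"
  by (rule finite_subset[of _ "Pow (order_ideals r)"])
    (auto simp: chains_below_def Chains_ideal_lattice_iff finite_order_ideals)

lemma flag_h_eq: "flag_h (ideal_lattice r) S = flag_h_below (Field r) S"
proof -
  have "elem_rank (ideal_lattice r) ` C = card ` C \<and> (\<forall>I\<in>C. I \<subseteq> Field r)"
    if "C \<in> Chains (ideal_lattice r)" for C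
  proof -
    have "C \<subseteq> order_ideals r" using that by (simp add: Chains_ideal_lattice_iff)
    then show ?thesis
      using elem_rank_ideal_lattice[OF partial_order finite_Field] order_ideal_subset
      by (auto simp: subset_iff image_iff)
  qed
  then have "flag_f (ideal_lattice r) T = card (chains_below (Field r) T)" for T
    unfolding flag_f_def chains_below_def by (intro arg_cong[where f = card]) auto
  then show ?thesis by (simp add: flag_h_def flag_h_below_def)
qed

lemma flag_h_below_empty: "flag_h_below x {} = 1"
proof -
  have "chains_below x {} = {{}}" by (auto simp: chains_below_def Chains_ideal_lattice_iff)
  then show ?thesis by (simp add: flag_h_below_def)
qed

text \<open>The chains are sorted by their top element \<open>y\<close>, the unique member of rank
  \<open>s\<close>; removing it leaves a chain below \<open>y\<close> with rank set
  \<open>T\<close>.\<close>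

lemma card_chains_below_insert:
  assumes "\<And>t. t \<in> T \<Longrightarrow> t < s"
  shows "card (chains_below x (insert s T)) = (\<Sum>y | y \<in> level s \<and> y \<subseteq> x. card (chains_below y T))"
proof -
  have sT: "s \<notin> T" using assms by blast
  let ?Y = "{y \<in> level s. y \<subseteq> x}"
  have notin: "y \<notin> C" if "y \<in> ?Y" "C \<in> chains_below y T" for y C
    using that sT by (auto simp: chains_below_def level_def)
  have "chains_below x (insert s T) = (\<Union>y\<in>?Y. insert y ` chains_below y T)" (is "?L = ?R")
  proof (intro set_eqI iffI)
    fix C assume "C \<in> ?L"
    then have C: "C \<subseteq> order_ideals r" "\<And>I K. I \<in> C \<Longrightarrow> K \<in> C \<Longrightarrow> I \<subseteq> K \<or> K \<subseteq> I"
      "\<And>I. I \<in> C \<Longrightarrow> I \<subseteq> x" "card ` C = insert s T"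
      by (auto simp: chains_below_def Chains_ideal_lattice_iff)
    obtain y where y: "y \<in> C" "card y = s" using C(4) by (metis image_iff insertI1)
    have ys: "y \<in> ?Y" using y C by (auto simp: level_def)
    have lt: "card I < s" if "I \<in> C" "I \<noteq> y" for I
    proof -
      have "card I \<noteq> card y"
        using C(2)[OF that(1) y(1)] that card_subset_eq order_ideal_finite C(1) y(1)
        by (metis subsetD)
      moreover have "card I \<in> insert s T" using C(4) that(1) by blast
      ultimately show ?thesis using assms y(2) by auto
    qed
    have "I \<subseteq> y" if "I \<in> C" for I
    proof (cases "I = y")
      case False
      have "\<not> y \<subseteq> I"
        using lt[OF that False] y(2) card_mono[OF order_ideal_finite, of I y] C(1) that by auto
      then show ?thesis using C(2)[OF that y(1)] by blast
    qed simp
    moreover have "card ` (C - {y}) = T"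
    proof
      show "card ` (C - {y}) \<subseteq> T"
      proof
        fix k assume "k \<in> card ` (C - {y})"
        then obtain I where "I \<in> C" "I \<noteq> y" "k = card I" by blast
        then have "k < s" "k \<in> insert s T" using lt[of I] C(4) by auto
        then show "k \<in> T" by simp
      qed
      show "T \<subseteq> card ` (C - {y})"
      proof
        fix k assume k: "k \<in> T"
        then obtain I where "I \<in> C" "k = card I" using C(4) by (metis image_iff insertI2)
        then show "k \<in> card ` (C - {y})" using k sT y(2) by blast
      qed
    qed
    ultimately have "C - {y} \<in> chains_below y T"
      using C(1,2) by (auto simp: chains_below_def Chains_ideal_lattice_iff)
    moreover have "C = insert y (C - {y})" using y by blast
    ultimately show "C \<in> ?R" using ys by blast
  next
    fix C assume "C \<in> ?R"
    then obtain y D where y: "y \<in> level s" "y \<subseteq> x" "D \<in> chains_below y T" "C = insert y D" by blast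
    then have "D \<subseteq> order_ideals r" "\<forall>I\<in>D. \<forall>K\<in>D. I \<subseteq> K \<or> K \<subseteq> I" "\<forall>I\<in>D. I \<subseteq> y" "card ` D = T"
      "y \<in> order_ideals r" "card y = s"
      by (auto simp: chains_below_def Chains_ideal_lattice_iff level_def)
    moreover from this have "\<forall>I\<in>D. I \<subseteq> x" using y(2) by blast
    ultimately show "C \<in> ?L"
      unfolding chains_below_def Chains_ideal_lattice_iff y(4) using y(2) by auto
  qed
  moreover have "card (insert y ` chains_below y T) = card (chains_below y T)" if "y \<in> ?Y" for y
  proof (rule card_image, rule inj_onI)
    fix C D assume "C \<in> chains_below y T" "D \<in> chains_below y T" "insert y C = insert y D"
    then show "C = D" using notin[OF that] by (metis insert_ident)
  qed
  moreover have "insert y ` chains_below y T \<inter> insert z ` chains_below z T = {}"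
    if "y \<in> ?Y" "z \<in> ?Y" "y \<noteq> z" for y z
  proof -
    have "card I \<noteq> s" if "I \<in> C" "C \<in> chains_below w T" for I C w
      using that sT by (auto simp: chains_below_def)
    then have "y \<notin> C" if "C \<in> chains_below z T" for C
      using that \<open>y \<in> ?Y\<close> by (auto simp: level_def)
    then show ?thesis using \<open>y \<noteq> z\<close> by blast
  qed
  ultimately show ?thesis
    using finite_level finite_chains_below by (simp add: card_UN_disjoint)
qed

text \<open>Split the subsets of \<open>insert s S\<close> by whether they contain \<open>s\<close>.
  Those without \<open>s\<close> give minus the old value, because the complement gains one element;
  those with \<open>s\<close> are evaluated by removing the tops of the chains.\<close>

lemma flag_h_below_insert:
  assumes "finite S" "\<And>t. t \<in> S \<Longrightarrow> t < s"
  shows "flag_h_below x (insert s S) =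
    (\<Sum>y | y \<in> level s \<and> y \<subseteq> x. flag_h_below y S) - flag_h_below x S"
proof -
  let ?n = "\<lambda>x T. int (card (chains_below x T))"
  have sS: "s \<notin> S" using assms by blast
  have inj: "inj_on (insert s) (Pow S)" using sS by (auto simp: inj_on_def)
  have "flag_h_below x (insert s S) =
      (\<Sum>T\<in>Pow S. (- 1) ^ card (insert s S - T) * ?n x T) +
      (\<Sum>T\<in>insert s ` Pow S. (- 1) ^ card (insert s S - T) * ?n x T)"
    unfolding flag_h_below_def Pow_insert
    using assms(1) sS by (intro sum.union_disjoint) auto
  also have "(\<Sum>T\<in>Pow S. (- 1) ^ card (insert s S - T) * ?n x T) = - flag_h_below x S"
    unfolding flag_h_below_def sum_negf[symmetric]
  proof (intro sum.cong refl)
    fix T assume "T \<in> Pow S"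
    then have "insert s S - T = insert s (S - T)" using sS by blast
    then show "(- 1) ^ card (insert s S - T) * ?n x T = - ((- 1) ^ card (S - T) * ?n x T)"
      using assms(1) sS by simp
  qed
  also have "(\<Sum>T\<in>insert s ` Pow S. (- 1) ^ card (insert s S - T) * ?n x T) =
      (\<Sum>T\<in>Pow S. (- 1) ^ card (insert s S - insert s T) * ?n x (insert s T))"
    using inj by (simp add: sum.reindex)
  also have "\<dots> = (\<Sum>T\<in>Pow S. \<Sum>y | y \<in> level s \<and> y \<subseteq> x. (- 1) ^ card (S - T) * ?n y T)"
  proof (intro sum.cong refl)
    fix T assume "T \<in> Pow S"
    then have "insert s S - insert s T = S - T" "\<And>t. t \<in> T \<Longrightarrow> t < s" using sS assms by blast+
    then show "(- 1) ^ card (insert s S - insert s T) * ?n x (insert s T) =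
        (\<Sum>y | y \<in> level s \<and> y \<subseteq> x. (- 1) ^ card (S - T) * ?n y T)"
      by (simp add: card_chains_below_insert sum_distrib_left)
  qed
  also have "\<dots> = (\<Sum>y | y \<in> level s \<and> y \<subseteq> x. flag_h_below y S)"
    unfolding flag_h_below_def by (rule sum.swap)
  finally show ?thesis by simp
qed

lemma cond_a_iff: "cond_a r \<longleftrightarrow> (\<forall>S \<subseteq> {1..card (Field r) - 1}. flag_h_below (Field r) S \<in> {- 1, 0, 1})"
  unfolding cond_a_def multiplicity_free_flag_h_def flag_h_eq
    poset_rank_ideal_lattice[OF partial_order finite_Field] ..

text \<open>The entry at \<open>{i}\<close> is one less than the number of ideals of size
  \<open>i\<close>; the ranks outside the range of \<open>S\<close> have at most one ideal
  anyway.\<close>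

lemma cond_a_imp_cond_b:
  assumes "cond_a r"
  shows "cond_b r"
  unfolding cond_b_iff
proof
  fix i
  consider "i = 0" | "i = card (Field r)" | "card (Field r) < i" | "i \<in> {1..card (Field r) - 1}"
    by fastforce
  then show "card (level i) \<le> 2"
  proof cases
    case 4
    have "{y. y \<in> level i \<and> y \<subseteq> Field r} = level i"
      using order_ideal_subset by (auto simp: level_def)
    then have "flag_h_below (Field r) {i} = int (card (level i)) - 1"
      using flag_h_below_insert[of "{}" i "Field r"] by (simp add: flag_h_below_empty)
    moreover have "flag_h_below (Field r) {i} \<in> {- 1, 0, 1}"
      using assms 4 unfolding cond_a_iff by blast
    ultimately show ?thesis by auto
  qed (simp_all add: level_0 level_top level_beyond)
qed


text \<open>The union exceeds either ideal by a single element. Being an ideal, it extends to every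
  rank from \<open>Suc i\<close> up to the top, and in rank \<open>Suc i\<close> the only ideal
  containing both is the union itself.\<close>

lemma card_Un_level:
  assumes "cond_c r" "X \<in> level i" "Y \<in> level i" "X \<noteq> Y"
  shows "card (X \<union> Y) = Suc i"
proof -
  obtain x y where xy: "X - Y = {x}" "Y - X = {y}" using exchange[OF assms] .
  then have "X \<union> Y = insert y X" "y \<notin> X" by blast+
  moreover have "finite X" "card X = i"
    using assms(2) order_ideal_finite by (auto simp: level_def)
  ultimately show ?thesis by simp
qed

text \<open>
  If \<open>x\<close> contains only one of two ideals of the new rank, exchange shows that this one
  contains every ideal of size \<open>Max S\<close> as soon as \<open>x\<close> does, so the two remaining terms cancel.
\<close>

lemma flag_h_below_cases:
  assumes b: "cond_b r" and "finite S"
  shows "\<exists>c\<in>{0, 1}. (c \<noteq> 0 \<longrightarrow> sparse S \<and> (S \<noteq> {} \<longrightarrow> card (level (Max S)) = 2)) \<and>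
    (\<forall>x\<in>order_ideals r. (\<forall>t\<in>S. t < card x) \<longrightarrow>
      flag_h_below x S = (if S \<noteq> {} \<longrightarrow> (\<forall>u\<in>level (Max S). u \<subseteq> x) then c else 0))"
  using assms(2)
proof (induction S rule: finite_linorder_max_induct)
  case empty
  show ?case
    by (intro bexI[of _ 1]) (auto simp: flag_h_below_empty sparse_def)
next
  case (insert s S)
  have cc: "cond_c r" using b cond_b_imp_cond_c by blast
  \<comment> \<open>By induction the value at \<open>S\<close> below \<open>x\<close> is
    \<open>c\<close> for a full \<open>x\<close> and 0 otherwise, so the recursion merely counts
    full ideals.\<close>
  define full where "full x \<longleftrightarrow> (S \<noteq> {} \<longrightarrow> (\<forall>u\<in>level (Max S). u \<subseteq> x))" for x
  from insert.IH obtain c :: int where c: "c \<in> {0, 1}"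
    and c0': "c \<noteq> 0 \<longrightarrow> sparse S \<and> (S \<noteq> {} \<longrightarrow> card (level (Max S)) = 2)"
    and below: "\<forall>x\<in>order_ideals r. (\<forall>t\<in>S. t < card x) \<longrightarrow>
      flag_h_below x S = (if full x then c else 0)"
    unfolding full_def by (elim bexE conjE)
  have c0: "c \<noteq> 0 \<Longrightarrow> sparse S" "c \<noteq> 0 \<Longrightarrow> S \<noteq> {} \<Longrightarrow> card (level (Max S)) = 2"
    using c0' by auto
  have Max: "Max (insert s S) = s"
    using insert.hyps by (intro Max_eqI) auto
  have MaxS: "Max S < s" if "S \<noteq> {}" using insert.hyps that by simp
  have sub: "flag_h_below x (insert s S) =
      (\<Sum>y | y \<in> level s \<and> y \<subseteq> x. if full y then c else 0) - (if full x then c else 0)"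
    if x: "x \<in> order_ideals r" "s < card x" for x
  proof -
    have "flag_h_below y S = (if full y then c else 0)" if "y \<in> level s" for y
      using that insert.hyps(2) by (intro below[rule_format]) (auto simp: level_def)
    moreover have "flag_h_below x S = (if full x then c else 0)"
      using x insert.hyps(2) by (intro below[rule_format]) (auto intro: less_trans)
    ultimately show ?thesis
      using insert.hyps by (subst flag_h_below_insert) auto
  qed
  have level_below: "\<exists>y\<in>level s. y \<subseteq> x" if "x \<in> order_ideals r" "s < card x" for x
    using order_ideal_between[OF order_ideal_empty that(1), of s] that(2) by auto
  have full_if: "full x" if x: "x \<in> order_ideals r" "s < card x" "\<forall>y\<in>level s. y \<subseteq> x" for x
    unfolding full_def
  proof (intro impI ballI)
    fix u assume "S \<noteq> {}" "u \<in> level (Max S)"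
    then have u: "u \<in> order_ideals r" "card u \<le> s" using MaxS by (auto simp: level_def)
    have "s \<le> card (Field r)"
      using x(2) card_mono[OF finite_Field order_ideal_subset[OF x(1)]] by simp
    then obtain L where "L \<in> level s" "u \<subseteq> L" "L \<subseteq> Field r"
      using order_ideal_between[OF u(1) order_ideal_Field order_ideal_subset[OF u(1)] u(2)] by blast
    then show "u \<subseteq> x" using x(3) by blast
  qed
  have mono: "full x" if "full y" "y \<subseteq> x" for x y
    using that unfolding full_def by blast
  show ?case
  \<comment> \<open>If \<open>c = 0\<close>, every term vanishes. If rank \<open>s\<close> has a
    single ideal \<open>z\<close>, then \<open>z\<close> and \<open>x\<close> are both full and
    their contributions cancel. The new constant is 0 in both cases.\<close>
  proof (cases "c = 0 \<or> card (level s) \<noteq> 2")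
    case True
    have "flag_h_below x (insert s S) = 0" if x: "x \<in> order_ideals r" "s < card x" for x
    proof (cases "c = 0")
      case False
      obtain z where z: "z \<in> level s" "z \<subseteq> x" using level_below[OF x] by blast
      have "card (level s) \<le> 2" using b cond_b_iff by blast
      moreover have "card (level s) \<noteq> 0" using z(1) finite_level by auto
      ultimately have "card (level s) = 1" using True False by linarith
      then have l: "level s = {z}" using z(1) by (auto simp: card_1_singleton_iff)
      have zi: "z \<in> order_ideals r" "card z = s" using z by (auto simp: level_def)
      have "full z" unfolding full_def
      proof (intro impI ballI)
        fix u assume "S \<noteq> {}" "u \<in> level (Max S)"
        then have u: "u \<in> order_ideals r" "card u \<le> s" using MaxS by (auto simp: level_def)
        have "s \<le> card (Field r)"
          using zi card_mono[OF finite_Field order_ideal_subset[OF zi(1)]] by simp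
        then obtain L where "L \<in> level s" "u \<subseteq> L" "L \<subseteq> Field r"
          using order_ideal_between[OF u(1) order_ideal_Field order_ideal_subset[OF u(1)] u(2)] by blast
        then show "u \<subseteq> z" using l by blast
      qed
      moreover have "{y. y \<in> level s \<and> y \<subseteq> x} = {z}" using l z by blast
      ultimately show ?thesis using sub[OF x] mono[OF _ z(2)] by simp
    next
      case True
      then have "(if full y then c else 0) = 0" for y by simp
      then show ?thesis unfolding sub[OF x] by simp
    qed
    then show ?thesis by (intro bexI[of _ 0]) auto
  next
    case False
    then have c1: "c = 1" and l2: "card (level s) = 2" using c by auto
    obtain y y' where yy: "level s = {y, y'}" "y \<noteq> y'"
      using l2 by (auto simp: card_2_iff)
    have yi: "y \<in> order_ideals r" "card y = s" "y' \<in> order_ideals r" "card y' = s"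
      using yy by (auto simp: level_def)
    have lS: "\<exists>u u'. level (Max S) = {u, u'} \<and> u \<union> u' \<in> order_ideals r \<and> card (u \<union> u') = Suc (Max S)"
      if ne: "S \<noteq> {}"
    proof -
      have "card (level (Max S)) = 2" using c0(2) c1 ne by simp
      then obtain u u' where u: "level (Max S) = {u, u'}" "u \<noteq> u'" by (auto simp: card_2_iff)
      then have "card (u \<union> u') = Suc (Max S)" by (intro card_Un_level[OF cc]) auto
      moreover have "u \<union> u' \<in> order_ideals r"
        using u by (intro order_ideal_Un) (auto simp: level_def)
      ultimately show ?thesis using u by blast
    qed
    \<comment> \<open>The union of the two ideals of rank \<open>Max S\<close> has at most
      \<open>s\<close> elements, so it is contained in \<open>y\<close> or in
      \<open>y'\<close>.\<close>
    have one: "full y \<or> full y'"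
    proof (cases "S = {}")
      case False
      then obtain u u' where u: "level (Max S) = {u, u'}" "u \<union> u' \<in> order_ideals r"
        "card (u \<union> u') = Suc (Max S)" using lS by blast
      have le: "card (u \<union> u') \<le> s" "s \<le> card (Field r)"
        using u(3) MaxS False yi(2) card_mono[OF finite_Field order_ideal_subset[OF yi(1)]] by auto
      obtain L where "L \<in> level s" "u \<union> u' \<subseteq> L" "L \<subseteq> Field r"
        using order_ideal_between[OF u(2) order_ideal_Field order_ideal_subset[OF u(2)] le] .
      then show ?thesis using u(1) yy(1) unfolding full_def by auto
    qed (simp add: full_def)
    \<comment> \<open>If \<open>x\<close> contains \<open>y\<close> and \<open>y'\<close>, the value
      is the number of full ideals among these two, minus 1 for \<open>x\<close> itself.\<close>
    let ?c' = "if full y \<and> full y' then 1 else 0 :: int"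
    have val: "flag_h_below x (insert s S) = (if \<forall>u\<in>level s. u \<subseteq> x then ?c' else 0)"
      if x: "x \<in> order_ideals r" "s < card x" for x
    proof (cases "\<forall>u\<in>level s. u \<subseteq> x")
      case True
      then have "{v. v \<in> level s \<and> v \<subseteq> x} = {y, y'}" using yy by blast
      then show ?thesis
        using sub[OF x] yy(2) full_if[OF x True] one True c1 by (cases "full y"; cases "full y'") simp_all
    next
      case False
      have eq: "full x \<longleftrightarrow> full z"
        if z: "z \<in> level s" "z' \<in> level s" "z \<noteq> z'" "z \<subseteq> x" "\<not> z' \<subseteq> x" "full z \<or> full z'" for z z'
      proof
        assume fx: "full x"
        show "full z"
        proof (rule ccontr)
          assume "\<not> full z"
          \<comment> \<open>All ideals of rank \<open>Max S\<close> lie in both \<open>x\<close> and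
            \<open>z'\<close>. The only element of \<open>z'\<close> outside \<open>z\<close> is
            \<open>w\<close>, which is not in \<open>x\<close>, so they all lie in
            \<open>z\<close>.\<close>
          then have "full z'" using z(6) by blast
          obtain v w where "z - z' = {v}" "z' - z = {w}" using exchange[OF cc z(1,2,3)] .
          then have w: "z' \<subseteq> insert w z" by blast
          then have "w \<notin> x" using z(4,5) by blast
          then have "x \<inter> z' \<subseteq> z" using w by blast
          then have "full z" using fx \<open>full z'\<close> unfolding full_def by blast
          then show False using \<open>\<not> full z\<close> by blast
        qed
      qed (use mono z(4) in blast)
      consider "y \<subseteq> x" "\<not> y' \<subseteq> x" | "y' \<subseteq> x" "\<not> y \<subseteq> x"
        using False level_below[OF x] yy by blast
      then show ?thesis
      proof cases
        case 1
        then have "{v. v \<in> level s \<and> v \<subseteq> x} = {y}" using yy by blast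
        then show ?thesis using sub[OF x] eq[of y y'] 1 yy one False by simp
      next
        case 2
        then have "{v. v \<in> level s \<and> v \<subseteq> x} = {y'}" using yy by blast
        then show ?thesis using sub[OF x] eq[of y' y] 2 yy one False by auto
      qed
    qed
    have "sparse (insert s S)" if "full y \<and> full y'"
    proof -
      \<comment> \<open>If \<open>S\<close> contained \<open>s - 1\<close>, the union of the two
        ideals of that rank would have exactly \<open>s\<close> elements, and the full ideals
        \<open>y\<close> and \<open>y'\<close> would both equal it.\<close>
      have "i + 1 \<noteq> s" if i: "i \<in> S" for i
      proof
        assume s: "i + 1 = s"
        have ne: "S \<noteq> {}" using i by blast
        then have "Max S = i" using MaxS i s insert.hyps(1) Max_ge[of S i] by fastforce
        then obtain u u' where u: "level i = {u, u'}" "card (u \<union> u') = s"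
          using lS[OF ne] s by auto
        have "u \<union> u' \<subseteq> y" "u \<union> u' \<subseteq> y'"
          using \<open>full y \<and> full y'\<close> u(1) ne \<open>Max S = i\<close> unfolding full_def by auto
        then have "u \<union> u' = y" "u \<union> u' = y'"
          using card_subset_eq[OF order_ideal_finite[OF yi(1)]] card_subset_eq[OF order_ideal_finite[OF yi(3)]]
            u(2) yi(2,4) by metis+
        then show False using yy(2) by simp
      qed
      moreover have "s + 1 \<notin> S" using insert.hyps(2) by fastforce
      moreover have "sparse S" using c0 c1 by simp
      ultimately show ?thesis unfolding sparse_def by auto
    qed
    then show ?thesis
      using val l2 by (intro bexI[of _ ?c']) (auto simp: Max)
  qed
qed

lemma cond_b_imp_flag_h_below:
  assumes "cond_b r" "S \<subseteq> {1..card (Field r) - 1}"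
  shows "flag_h_below (Field r) S \<in> {0, 1}" "flag_h_below (Field r) S \<noteq> 0 \<Longrightarrow> sparse S"
proof -
  have "finite S" using assms(2) finite_subset by blast
  from flag_h_below_cases[OF assms(1) this] obtain c :: int where c: "c \<in> {0, 1}"
    "c \<noteq> 0 \<longrightarrow> sparse S \<and> (S \<noteq> {} \<longrightarrow> card (level (Max S)) = 2)"
    "\<forall>x\<in>order_ideals r. (\<forall>t\<in>S. t < card x) \<longrightarrow>
      flag_h_below x S = (if S \<noteq> {} \<longrightarrow> (\<forall>u\<in>level (Max S). u \<subseteq> x) then c else 0)"
    by (elim bexE conjE)
  have "\<forall>t\<in>S. t < card (Field r)" using assms(2) by fastforce
  then have "flag_h_below (Field r) S \<in> {0, c}" using c(3) order_ideal_Field by simp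
  then show "flag_h_below (Field r) S \<in> {0, 1}" "flag_h_below (Field r) S \<noteq> 0 \<Longrightarrow> sparse S"
    using c(1,2) by auto
qed

lemma cond_a_iff_cond_b: "cond_a r \<longleftrightarrow> cond_b r"
  using cond_a_imp_cond_b cond_b_imp_flag_h_below(1) unfolding cond_a_iff by blast

lemma irreducible_iff_level:
  assumes "cond_b r"
  shows "\<not> nontrivial_ordinal_sum r \<longleftrightarrow> (\<forall>i\<in>{1..card (Field r) - 1}. card (level i) = 2)"
proof -
  have "card (level i) \<noteq> 1 \<longleftrightarrow> card (level i) = 2" if "i \<in> {1..card (Field r) - 1}" for i
  proof -
    have "card (level i) \<le> 2" using assms cond_b_iff by blast
    moreover have "i \<le> card (Field r)" using that by auto
    then have "card (level i) \<noteq> 0"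
      using level_nonempty[of i] finite_level by simp
    ultimately show ?thesis by linarith
  qed
  then show ?thesis unfolding nontrivial_ordinal_sum_iff_level by blast
qed

end

section \<open>Encoding by words\<close>

text \<open>
  A word, whose head is the most recent step, builds a poset on an initial segment of the naturals by
  adding new maximal elements. The new element lies above all earlier ones
  except possibly one, which is either the newest of them or the one skipped in the previous step.
\<close>

datatype step = Above_all | Skip_newest | Skip_same

text \<open>Elements are numbered in order of insertion, so the newest element of a nonempty
  \<open>w\<close> is \<open>length w - 1\<close>. \<open>None\<close> means that nothing is
  skipped; this includes \<open>Skip_newest\<close> on the empty word, which
  \<open>canonical\<close> rejects.\<close>

fun skipped :: "step list \<Rightarrow> nat option" where
  "skipped [] = None"
| "skipped (Above_all # w) = None"
| "skipped (Skip_newest # w) = (if w = [] then None else Some (length w - 1))"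
| "skipped (Skip_same # w) = skipped w"

fun word_rel :: "step list \<Rightarrow> nat rel" where
  "word_rel [] = {}"
| "word_rel (l # w) = word_rel w \<union> {(i, length w) |i. i \<le> length w \<and> skipped (l # w) \<noteq> Some i}"

text \<open>
  There is one maximal element, or there are two, which are interchangeable or not. In the
  interchangeable case the two ways of skipping a maximal element give isomorphic posets, and
  canonical words then use only one of them.
\<close>

datatype shape = Single | Twins | Skew

text \<open>Skipping a greatest element makes two maximal elements lying above exactly the same
  others, hence \<open>Twins\<close>. Skipping one of two maximal elements puts the new one above
  the other; its principal ideal is then larger than that of the skipped one, hence
  \<open>Skew\<close>.\<close>

fun top_shape :: "step list \<Rightarrow> shape" where
  "top_shape [] = Single"
| "top_shape (Above_all # w) = Single"
| "top_shape (Skip_newest # w) = (if top_shape w = Single then Twins else Skew)"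
| "top_shape (Skip_same # w) = Skew"

text \<open>\<open>Skip_newest\<close> on the empty word would duplicate \<open>Above_all\<close>.
  \<open>Skip_same\<close> duplicates \<open>Above_all\<close> after \<open>Single\<close>, where
  nothing is skipped, and is equivalent to \<open>Skip_newest\<close> after \<open>Twins\<close>, so
  it is kept only after \<open>Skew\<close>.\<close>

fun canonical :: "step list \<Rightarrow> bool" where
  "canonical [] = True"
| "canonical (Above_all # w) = canonical w"
| "canonical (Skip_newest # w) = (w \<noteq> [] \<and> canonical w)"
| "canonical (Skip_same # w) = (canonical w \<and> top_shape w = Skew)"

declare word_rel.simps(2) [simp del]

lemma skipped_less: "skipped w = Some i \<Longrightarrow> Suc i < length w"
  by (induction w rule: skipped.induct) (auto split: if_splits)

lemma canonical_Cons: "canonical (l # w) \<Longrightarrow> canonical w"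
  by (cases l) auto

lemma top_shape_Single_iff: "canonical w \<Longrightarrow> top_shape w = Single \<longleftrightarrow> skipped w = None"
  by (induction w rule: canonical.induct) auto

lemma skipped_None_iff: "canonical (l # w) \<Longrightarrow> skipped (l # w) = None \<longleftrightarrow> l = Above_all"
  using top_shape_Single_iff[of w] by (cases l) auto

lemma top_shape_TwinsE:
  assumes "canonical w" "top_shape w = Twins"
  obtains v where "w = Skip_newest # Above_all # v"
proof -
  obtain l v where w: "w = l # v" using assms by (cases w) auto
  then have l: "l = Skip_newest" "top_shape v = Single" "v \<noteq> []" "canonical v"
    using assms by (cases l; auto split: if_splits)+
  then obtain k u where v: "v = k # u" by (cases v) auto
  then have "k = Above_all" using l by (cases k) (auto split: if_splits)
  then show ?thesis using that w v l by blast
qed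

lemma word_rel_bound: "(i, j) \<in> word_rel w \<Longrightarrow> i \<le> j \<and> j < length w"
  by (induction w) (auto simp: word_rel.simps(2))

lemma word_rel_Cons_less: "j < length w \<Longrightarrow> (i, j) \<in> word_rel (l # w) \<longleftrightarrow> (i, j) \<in> word_rel w"
  by (auto simp: word_rel.simps(2))

lemma word_rel_Cons_newest:
  "(i, length w) \<in> word_rel (l # w) \<longleftrightarrow> i \<le> length w \<and> skipped (l # w) \<noteq> Some i"
  using word_rel_bound[of i "length w" w] by (auto simp: word_rel.simps(2))

lemma word_rel_refl: "i < length w \<Longrightarrow> (i, i) \<in> word_rel w"
proof (induction w)
  case (Cons l w)
  show ?case
  proof (cases "i < length w")
    case False
    then have "i = length w" using Cons.prems by simp
    then show ?thesis using skipped_less[of "l # w" i] word_rel_Cons_newest[of i w l] by auto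
  qed (use Cons word_rel_Cons_less in auto)
qed simp

lemma Field_word_rel: "Field (word_rel w) = {..<length w}"
  using word_rel_bound word_rel_refl by (fastforce simp: Field_def)

text \<open>The newest element of the shorter word is maximal there, a repeated exception is maximal
  by induction, and the added element is not above it. Without this, adding an element would destroy
  transitivity.\<close>

lemma skipped_maximal: "skipped w = Some i \<Longrightarrow> (i, j) \<in> word_rel w \<Longrightarrow> j = i"
proof (induction w)
  case (Cons l w)
  have j: "i \<le> j" "j < Suc (length w)" using word_rel_bound[OF Cons.prems(2)] by auto
  have "j \<noteq> length w" using Cons.prems word_rel_Cons_newest[of i w l] by auto
  then have jw: "j < length w" "(i, j) \<in> word_rel w"
    using j Cons.prems(2) word_rel_Cons_less[of j w i l] by auto
  show ?case
  proof (cases l)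
    case Above_all
    then show ?thesis using Cons.prems(1) by simp
  next
    case Skip_newest
    then show ?thesis using Cons.prems(1) j(1) jw(1) by (auto split: if_splits)
  next
    case Skip_same
    then show ?thesis using Cons.IH Cons.prems(1) jw(2) by simp
  qed
qed simp

lemma skipped_Cons_maximal:
  assumes "skipped (l # w) = Some i" "(i, j) \<in> word_rel w"
  shows "j = i"
proof -
  have "j < length w" using word_rel_bound[OF assms(2)] by simp
  then have "(i, j) \<in> word_rel (l # w)" using assms(2) word_rel_Cons_less by blast
  then show ?thesis using skipped_maximal[OF assms(1)] by blast
qed

text \<open>Everything else lies below the newest element, so there are at most two maximal
  elements.\<close>

lemma maximal_word_rel:
  assumes "i < length w" "\<And>j. (i, j) \<in> word_rel w \<Longrightarrow> j = i"
  shows "i = length w - 1 \<or> skipped w = Some i"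
proof -
  obtain l v where w: "w = l # v" using assms(1) by (cases w) auto
  then show ?thesis
    using assms(1) assms(2)[of "length v"] word_rel_Cons_newest[of i v l] by auto
qed

lemma word_rel_trans: "(i, j) \<in> word_rel w \<Longrightarrow> (j, k) \<in> word_rel w \<Longrightarrow> (i, k) \<in> word_rel w"
proof (induction w)
  case (Cons l w)
  note b = word_rel_bound[OF Cons.prems(1)] word_rel_bound[OF Cons.prems(2)]
  consider "k < length w" | "k = length w" "j = length w" | "k = length w" "j < length w"
    using b by fastforce
  then show ?case
  proof cases
    case 1
    then have "j < length w" using b by simp
    then show ?thesis using 1 Cons word_rel_Cons_less[of j w i l] word_rel_Cons_less[of k w _ l] by simp
  next
    case 2
    then show ?thesis using Cons.prems by simp
  next
    case 3
    have ij: "(i, j) \<in> word_rel w" using 3 Cons.prems(1) word_rel_Cons_less by blast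
    have "skipped (l # w) \<noteq> Some j" using Cons.prems(2) 3 word_rel_Cons_newest by blast
    then have "skipped (l # w) \<noteq> Some i" using skipped_Cons_maximal[OF _ ij] by blast
    then show ?thesis using 3 b word_rel_Cons_newest[of i w l] by simp
  qed
qed simp

lemma finite_poset_word_rel: "finite_poset (word_rel w)"
proof
  have "antisym (word_rel w)"
    using word_rel_bound by (meson antisymI le_antisym)
  moreover have "trans (word_rel w)" using word_rel_trans by (meson transI)
  moreover have "refl_on (Field (word_rel w)) (word_rel w)"
    using word_rel_refl by (auto simp: refl_on_def Field_word_rel)
  ultimately show "Partial_order (word_rel w)"
    by (auto simp: partial_order_on_def preorder_on_def FieldI1 FieldI2)
  show "finite (Field (word_rel w))" by (simp add: Field_word_rel)
qed

lemma word_rel_not_below_unique: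
  "k < length w \<Longrightarrow> i < k \<Longrightarrow> j < k \<Longrightarrow> (i, k) \<notin> word_rel w \<Longrightarrow> (j, k) \<notin> word_rel w \<Longrightarrow> i = j"
proof (induction w)
  case (Cons l w)
  show ?case
  proof (cases "k < length w")
    case True
    then show ?thesis using Cons word_rel_Cons_less[of k w _ l] by simp
  next
    case False
    then have "k = length w" using Cons.prems(1) by simp
    then show ?thesis using Cons.prems word_rel_Cons_newest[of _ w l] by auto
  qed
qed simp

text \<open>Each element fails to lie above at most one earlier element. In a 2+2, the later of the
  two tops would miss both elements of the other chain; in an antichain of three, the latest element
  would miss the other two.\<close>

lemma cond_c_word_rel: "cond_c (word_rel w)"
proof -
  interpret finite_poset "word_rel w" by (rule finite_poset_word_rel)
  have "(a, d) \<in> word_rel w \<or> (c, b) \<in> word_rel w"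
    if "(a, b) \<in> word_rel w" "a \<noteq> b" "(c, d) \<in> word_rel w" "c \<noteq> d" for a b c d
  proof (rule ccontr)
    assume n: "\<not> ((a, d) \<in> word_rel w \<or> (c, b) \<in> word_rel w)"
    have lt: "a < b" "b < length w" "c < d" "d < length w"
      using that word_rel_bound by (auto simp: le_less)
    have nn: "(b, d) \<notin> word_rel w" "(d, b) \<notin> word_rel w"
      using n that word_rel_trans by blast+
    have "b \<noteq> d" using nn word_rel_refl lt by auto
    then show False
      using n nn lt word_rel_not_below_unique[of d w a b] word_rel_not_below_unique[of b w c d] by linarith
  qed
  then have "two_plus_two_free (word_rel w)" unfolding two_plus_two_free_iff by blast
  moreover have "one_plus_one_plus_one_free (word_rel w)"
    unfolding one_plus_one_plus_one_free_iff
  proof (rule notI, elim exE conjE)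
    fix a b c assume abc: "antichain (word_rel w) {a, b, c}" "a \<noteq> b" "a \<noteq> c" "b \<noteq> c"
    have "a < length w" "b < length w" "c < length w"
      "(a, b) \<notin> word_rel w" "(b, a) \<notin> word_rel w" "(a, c) \<notin> word_rel w" "(c, a) \<notin> word_rel w"
      "(b, c) \<notin> word_rel w" "(c, b) \<notin> word_rel w"
      using abc by (auto simp: antichain_def Field_word_rel)
    then show False
      using abc(2-4) word_rel_not_below_unique[of a w b c] word_rel_not_below_unique[of b w a c]
        word_rel_not_below_unique[of c w a b] by linarith
  qed
  ultimately show ?thesis by (simp add: cond_c_def)
qed

section \<open>Uniqueness of the canonical word\<close>

lemma poset_iso_maximal:
  assumes "bij_betw f (Field r) (Field s)"
    "\<forall>x\<in>Field r. \<forall>y\<in>Field r. (x, y) \<in> r \<longleftrightarrow> (f x, f y) \<in> s"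
    "x \<in> Field r" "\<And>y. (x, y) \<in> r \<Longrightarrow> y = x" "(f x, z) \<in> s"
  shows "z = f x"
proof -
  have "z \<in> Field s" using assms(5) by (auto simp: FieldI2)
  then obtain y where y: "y \<in> Field r" "z = f y" using assms(1) by (auto simp: bij_betw_def)
  then have "(x, y) \<in> r" using assms(2,3,5) by blast
  then show ?thesis using assms(4)[of y] y(2) by simp
qed

lemma poset_iso_card_under:
  assumes "bij_betw f (Field r) (Field s)"
    "\<forall>x\<in>Field r. \<forall>y\<in>Field r. (x, y) \<in> r \<longleftrightarrow> (f x, f y) \<in> s"
    "x \<in> Field r"
  shows "card (under s (f x)) = card (under r x)"
proof -
  have "f ` under r x = under s (f x)"
  proof (intro equalityI subsetI)
    fix z assume "z \<in> f ` under r x"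
    then show "z \<in> under s (f x)" using assms(2,3) by (auto simp: under_def FieldI1)
  next
    fix z assume z: "z \<in> under s (f x)"
    then have "z \<in> Field s" by (auto simp: under_def FieldI1)
    then obtain y where y: "y \<in> Field r" "z = f y" using assms(1) by (auto simp: bij_betw_def)
    then have "y \<in> under r x" using z assms(2,3) by (auto simp: under_def)
    then show "z \<in> f ` under r x" using y(2) by blast
  qed
  moreover have "inj_on f (under r x)"
    using assms(1) by (auto simp: bij_betw_def under_def FieldI1 intro: inj_on_subset)
  ultimately show ?thesis by (metis card_image)
qed

lemma card_under_newest:
  assumes "skipped (l # w) = Some u"
  shows "card (under (word_rel (l # w)) (length w)) = length w"
proof -
  have u: "u < length w" using skipped_less[OF assms] by simp
  have "under (word_rel (l # w)) (length w) = {..length w} - {u}"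
    using assms word_rel_Cons_newest[of _ w l] by (auto simp: under_def)
  then show ?thesis using u by simp
qed

text \<open>Elements below \<open>u\<close> have index at most \<open>u\<close>, so a principal
  ideal this large forces \<open>u\<close> to be the newest element of \<open>w\<close> and to lie
  above all of \<open>w\<close>. By \<open>card_under_newest\<close> the added element attains the
  same size when something is skipped, so equal sizes identify twins.\<close>

lemma card_under_eq_length:
  assumes "card (under (word_rel (l # w)) u) = length w" "u < length w"
  shows "Suc u = length w \<and> skipped w = None"
proof -
  have sub: "under (word_rel (l # w)) u \<subseteq> {..u}"
    using word_rel_bound by (auto simp: under_def)
  then have "card (under (word_rel (l # w)) u) \<le> Suc u"
    using card_mono[OF finite_atMost sub] by simp
  then have u: "Suc u = length w" using assms by simp
  then have eq: "under (word_rel (l # w)) u = {..u}"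
    using assms(1) sub by (intro card_subset_eq) auto
  obtain k v where w: "w = k # v" using assms(2) by (cases w) auto
  then have uv: "u = length v" using u by simp
  have "skipped w \<noteq> Some i" for i
  proof
    assume i: "skipped w = Some i"
    then have "i \<in> under (word_rel (l # w)) u"
      using eq skipped_less[OF i] u by auto
    then have "(i, u) \<in> word_rel (l # w)" by (simp add: under_def)
    then have "(i, length v) \<in> word_rel (k # v)"
      using word_rel_Cons_less[of u w i l] assms(2) w uv by simp
    then show False using word_rel_Cons_newest[of i v k] i w by simp
  qed
  then show ?thesis using u by (cases "skipped w") auto
qed

text \<open>Equal sizes would mean that the preceding word has a greatest element, and then the
  shape could not be \<open>Skew\<close>.\<close>

lemma card_under_maximal_neq:
  assumes "canonical v" "top_shape v = Skew" "skipped v = Some u"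
  shows "card (under (word_rel v) (length v - 1)) \<noteq> card (under (word_rel v) u)"
proof
  assume eq: "card (under (word_rel v) (length v - 1)) = card (under (word_rel v) u)"
  obtain k w where v: "v = k # w" using assms(2) by (cases v) auto
  have "card (under (word_rel (k # w)) u) = length w"
    using eq card_under_newest[of k w u] assms(3) v by simp
  moreover have "u < length w" using skipped_less[OF assms(3)] v by simp
  ultimately have "skipped w = None" using card_under_eq_length by blast
  then have "top_shape w = Single"
    using assms(1) v canonical_Cons top_shape_Single_iff by blast
  then show False using assms v by (cases k) auto
qed

lemma bij_betw_restrict:
  assumes "bij_betw f A A" "B \<subseteq> A" "f ` (A - B) = A - B"
  shows "bij_betw f B B"
proof -
  have "f ` (A - (A - B)) = f ` A - f ` (A - B)"
    using assms(1) by (intro inj_on_image_set_diff[of f A]) (auto simp: bij_betw_def)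
  then have "f ` B = B" using assms by (simp add: bij_betw_def double_diff)
  then show ?thesis using assms inj_on_subset by (fastforce simp: bij_betw_def)
qed

text \<open>
  An isomorphism either fixes the newest element and restricts to the previous step, or it swaps
  the two maximal elements; comparing sizes of principal ideals, the latter forces both
  pairs to be interchangeable, and one restricts by two steps.
\<close>

lemma canonical_word_rel_inj:
  assumes "canonical w" "canonical w'" "poset_iso (word_rel w) (word_rel w')"
  shows "w = w'"
  using assms
proof (induction "length w" arbitrary: w w' rule: less_induct)
  case less
  obtain f where f: "bij_betw f {..<length w} {..<length w'}"
    "\<forall>x\<in>{..<length w}. \<forall>y\<in>{..<length w}. (x, y) \<in> word_rel w \<longleftrightarrow> (f x, f y) \<in> word_rel w'"
    using less.prems(3) unfolding poset_iso_def Field_word_rel by blast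
  have len: "length w' = length w" using bij_betw_same_card[OF f(1)] by simp
  show ?case
  proof (cases w)
    case Nil
    then show ?thesis using len by simp
  next
    case (Cons l v)
    then obtain l' v' where w': "w' = l' # v'" using len by (cases w') auto
    note w = Cons
    define n where "n = length v"
    have n: "length v = n" "length v' = n" "length w = Suc n" "length w' = Suc n"
      using len w w' by (auto simp: n_def)
    have can: "canonical v" "canonical v'"
      using less.prems w w' canonical_Cons by blast+
    have fb: "bij_betw f {..<Suc n} {..<Suc n}" using f(1) n by simp
    have fiso: "(x, y) \<in> word_rel w \<longleftrightarrow> (f x, f y) \<in> word_rel w'" if "x \<le> n" "y \<le> n" for x y
      using f(2) that n by auto
    have f_le: "f x \<le> n" if "x \<le> n" for x
      using bij_betw_apply[OF fb, of x] that by simp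
    have f_surj: "\<exists>x\<le>n. f x = y" if "y \<le> n" for y
    proof -
      have "y \<in> f ` {..<Suc n}" using fb that by (simp add: bij_betw_def)
      then show ?thesis by (auto simp: less_Suc_eq_le)
    qed
    have f_inj: "x = y" if "x \<le> n" "y \<le> n" "f x = f y" for x y
      using fb that by (auto simp: bij_betw_def inj_on_def)
    have newest: "(i, n) \<in> word_rel w \<longleftrightarrow> i \<le> n \<and> skipped w \<noteq> Some i"
      "(i, n) \<in> word_rel w' \<longleftrightarrow> i \<le> n \<and> skipped w' \<noteq> Some i" for i
      using word_rel_Cons_newest[of i v l] word_rel_Cons_newest[of i v' l'] n w w' by auto
    have restrict: "poset_iso (word_rel v) (word_rel v')" if fn: "f n = n"
    proof -
      have b: "bij_betw f {..<n} {..<n}"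
      proof (rule bij_betw_restrict[OF fb])
        have "{..<Suc n} - {..<n} = {n}" by auto
        then show "f ` ({..<Suc n} - {..<n}) = {..<Suc n} - {..<n}" using fn by simp
      qed auto
      moreover have "(x, y) \<in> word_rel v \<longleftrightarrow> (f x, f y) \<in> word_rel v'" if "x < n" "y < n" for x y
        using fiso[of x y] that bij_betw_apply[OF b, of y]
          word_rel_Cons_less[of y v x l] word_rel_Cons_less[of "f y" v' "f x" l'] n w w' by simp
      ultimately show ?thesis
        unfolding poset_iso_def Field_word_rel using n by (intro exI[of _ f]) auto
    qed
    show ?thesis
    proof (cases "skipped w")
      \<comment> \<open>Nothing is skipped, so \<open>n\<close> is the greatest element, and its
        image has to be the newest element on the other side.\<close>
      case None
      obtain x where x: "x \<le> n" "f x = n" using f_surj by blast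
      have "(x, n) \<in> word_rel w" using newest(1) None x by simp
      then have "(n, f n) \<in> word_rel w'" using fiso[of x n] x by simp
      then have fn: "f n = n" using word_rel_bound[of n "f n" w'] n by simp
      have "skipped w' \<noteq> Some i" for i
      proof
        assume i: "skipped w' = Some i"
        then have "i \<le> n" using skipped_less[OF i] n by simp
        then obtain y where "y \<le> n" "f y = i" using f_surj by blast
        then have "(i, n) \<in> word_rel w'" using fiso[of y n] fn newest(1)[of y] None by simp
        then show False using newest(2) i by simp
      qed
      then have "skipped w' = None" by (cases "skipped w'") auto
      then have "l = Above_all" "l' = Above_all"
        using None skipped_None_iff less.prems w w' by blast+
      moreover have "v = v'" using less.hyps[OF _ can restrict[OF fn]] w by simp
      ultimately show ?thesis using w w' by simp
    next
      case (Some u)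
      have u: "u < n" using skipped_less[OF Some] n by simp
      have max_n: "j = n" if "(n, j) \<in> word_rel w" for j
        using word_rel_bound[OF that] n by simp
      \<comment> \<open>Maximal elements go to maximal elements, and these can only be the newest
        and the skipped one.\<close>
      have fmax: "f x \<in> {n} \<union> set_option (skipped w')"
        if x: "x \<le> n" "\<And>y. (x, y) \<in> word_rel w \<Longrightarrow> y = x" for x
      proof -
        have "z = f x" if "(f x, z) \<in> word_rel w'" for z
          using poset_iso_maximal[of f "word_rel w" "word_rel w'" x z] f x that n
          unfolding Field_word_rel by simp
        then show ?thesis
          using maximal_word_rel[of "f x" w'] f_le[OF x(1)] n by auto
      qed
      have fn: "f n \<in> {n} \<union> set_option (skipped w')" using fmax[of n] max_n by simp
      have fu: "f u \<in> {n} \<union> set_option (skipped w')"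
        using fmax[of u] u skipped_maximal[OF Some] by simp
      have neq: "f n \<noteq> f u" using f_inj[of n u] u by auto
      then obtain u' where u': "skipped w' = Some u'" using fn fu by (cases "skipped w'") auto
      have u'n: "u' < n" using skipped_less[OF u'] n by simp
      have card_f: "card (under (word_rel w') (f x)) = card (under (word_rel w) x)" if "x \<le> n" for x
        using poset_iso_card_under[of f "word_rel w" "word_rel w'" x] f that n
        unfolding Field_word_rel by simp
      have card_n: "card (under (word_rel w) n) = n" "card (under (word_rel w') n) = n"
        using card_under_newest[of l v u] card_under_newest[of l' v' u'] Some u' w w' n by simp_all
      show ?thesis
      proof (cases "f n = n")
        case True
        then have fu': "f u = u'" using fu neq u' by auto
        have vv: "v = v'" using less.hyps[OF _ can restrict[OF True]] w by simp
        have "under (word_rel w) u = under (word_rel v) u" "under (word_rel w') u' = under (word_rel v') u'"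
          using word_rel_Cons_less[of u v _ l] word_rel_Cons_less[of u' v' _ l'] u u'n n w w'
          by (auto simp: under_def)
        \<comment> \<open>As \<open>v = v'\<close>, this compares two elements of one poset. If the
          last letters differed, \<open>u\<close> and \<open>u'\<close> would be the two maximal
          elements of a \<open>Skew\<close> word, whose principal ideals differ in size.\<close>
        then have eq: "card (under (word_rel v) u') = card (under (word_rel v) u)"
          using card_f[of u] fu' u vv by simp
        have ne: "l \<noteq> Above_all" "l' \<noteq> Above_all" using Some u' w w' by auto
        have "l = l'"
        proof (rule ccontr)
          assume "l \<noteq> l'"
          then consider "l = Skip_newest" "l' = Skip_same" | "l = Skip_same" "l' = Skip_newest"
            using ne by (cases l; cases l') auto
          then show False
          proof cases
            case 1
            then have "u = length v - 1" "skipped v = Some u'" "top_shape v = Skew"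
              using Some u' w w' vv less.prems by (auto split: if_splits)
            then show False using card_under_maximal_neq[OF can(1)] eq by metis
          next
            case 2
            then have "u' = length v - 1" "skipped v = Some u" "top_shape v = Skew"
              using Some u' w w' vv less.prems by (auto split: if_splits)
            then show False using card_under_maximal_neq[OF can(1)] eq by metis
          qed
        qed
        then show ?thesis using vv w w' by simp
      next
        case False
        then have fn': "f n = u'" using fn u' by auto
        then have fu': "f u = n" using fu neq u' by auto
        have "card (under (word_rel (l' # v')) u') = length v'"
          using card_f[of n] fn' card_n w' n by simp
        then have s': "Suc u' = n" "skipped v' = None"
          using card_under_eq_length[of l' v' u'] u'n n by auto
        have "card (under (word_rel (l # v)) u) = length v"
          using card_f[of u] fu' card_n w n u by simp
        then have s: "Suc u = n" "skipped v = None"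
          using card_under_eq_length[of l v u] u n by auto
        have "top_shape v = Single" "top_shape v' = Single"
          using top_shape_Single_iff can s(2) s'(2) by blast+
        then have l: "l = Skip_newest" "l' = Skip_newest"
          using less.prems w w' Some u' by (cases l; cases l'; simp)+
        obtain k x k' x' where vx: "v = k # x" "v' = k' # x'" using s(1) n by (cases v; cases v') auto
        then have k: "k = Above_all" "k' = Above_all"
          using skipped_None_iff can s(2) s'(2) by blast+
        have ux: "length x = u" "length x' = u" "u' = u" using vx s(1) s'(1) n by auto
        have b: "bij_betw f {..<u} {..<u}"
        proof (rule bij_betw_restrict[OF fb])
          have "{..<Suc n} - {..<u} = {u, n}" using s(1) by auto
          then show "f ` ({..<Suc n} - {..<u}) = {..<Suc n} - {..<u}" using fn' fu' ux by auto
        qed (use u in auto)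
        have "(a, b) \<in> word_rel w \<longleftrightarrow> (a, b) \<in> word_rel x"
          "(a, b) \<in> word_rel w' \<longleftrightarrow> (a, b) \<in> word_rel x'" if "b < u" for a b
          using that ux u n w w' vx word_rel_Cons_less[of b v a l] word_rel_Cons_less[of b x a k]
            word_rel_Cons_less[of b v' a l'] word_rel_Cons_less[of b x' a k'] by auto
        then have "(a, b) \<in> word_rel x \<longleftrightarrow> (f a, f b) \<in> word_rel x'" if "a < u" "b < u" for a b
          using fiso[of a b] that u bij_betw_apply[OF \<open>bij_betw f {..<u} {..<u}\<close>, of b] by simp
        with b have "poset_iso (word_rel x) (word_rel x')"
          unfolding poset_iso_def Field_word_rel ux by (intro exI[of _ f]) auto
        moreover have "canonical x" "canonical x'" using can vx canonical_Cons by blast+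
        ultimately have "x = x'" using less.hyps[of x x'] w vx by simp
        then show ?thesis using w w' vx k l by simp
      qed
    qed
  qed
qed

section \<open>Existence of a canonical word\<close>

context finite_poset
begin

lemma finite_poset_Restr: "finite_poset (Restr r A)"
  using Partial_order_Restr[OF partial_order] finite_subset[OF _ finite_Field, of "Field (Restr r A)"]
  by (auto simp: finite_poset_def Field_def)

lemma Field_Restr: "A \<subseteq> Field r \<Longrightarrow> Field (Restr r A) = A"
  using partial_order by (intro Refl_Field_Restr2) (auto simp: partial_order_on_def preorder_on_def)

lemma cond_c_Restr:
  assumes "cond_c r"
  shows "cond_c (Restr r A)"
proof -
  interpret R: finite_poset "Restr r A" by (rule finite_poset_Restr)
  have "two_plus_two_free (Restr r A)"
    using assms unfolding cond_c_def two_plus_two_free_iff R.two_plus_two_free_iff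
    by blast
  moreover have "one_plus_one_plus_one_free (Restr r A)"
    unfolding one_plus_one_plus_one_free_def
  proof (rule notI, elim exE conjE)
    fix B assume B: "antichain (Restr r A) B" "card B = 3"
    have "Field (Restr r A) \<subseteq> Field r \<inter> A" by (auto simp: Field_def)
    then have "antichain r B" using B(1) unfolding antichain_def by blast
    then show False using assms B(2) unfolding cond_c_def one_plus_one_plus_one_free_def by blast
  qed
  ultimately show ?thesis by (simp add: cond_c_def)
qed

text \<open>There are at most two maximal elements \<open>u\<close> and \<open>v\<close>. Suppose
  \<open>v\<close> misses some \<open>x\<close> other than \<open>u\<close>; then \<open>x\<close>
  is below \<open>u\<close>. Any \<open>y\<close> other than \<open>v\<close> that is not below
  \<open>u\<close> would be below \<open>v\<close>, and the chains from \<open>x\<close> to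
  \<open>u\<close> and from \<open>y\<close> to \<open>v\<close> would form a 2+2. So
  \<open>u\<close> misses only \<open>v\<close>.\<close>

lemma exists_above_almost_all:
  assumes c: "cond_c r" and ne: "Field r \<noteq> {}"
  obtains v where "v \<in> Field r" "\<And>y. (v, y) \<in> r \<Longrightarrow> y = v"
    "\<And>x y. x \<in> Field r \<Longrightarrow> y \<in> Field r \<Longrightarrow> (x, v) \<notin> r \<Longrightarrow> (y, v) \<notin> r \<Longrightarrow> x = y"
proof -
  let ?max = "\<lambda>v. v \<in> Field r \<and> (\<forall>y. (v, y) \<in> r \<longrightarrow> y = v)"
  have above: "\<exists>v. ?max v \<and> (a, v) \<in> r" if a: "a \<in> Field r" for a
  proof -
    obtain v where "(a, v) \<in> r" "\<And>y. (v, y) \<in> r \<Longrightarrow> y = v"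
      using exists_maximal_above[OF a] by metis
    then show ?thesis by (intro exI[of _ v]) (auto simp: FieldI2)
  qed
  obtain v where v: "?max v" using above ne by blast
  show ?thesis
  proof (cases "\<exists>u. ?max u \<and> u \<noteq> v")
    case False
    then have "(a, v) \<in> r" if "a \<in> Field r" for a using above[OF that] by blast
    then show ?thesis using that v by blast
  next
    case True
    then obtain u where u: "?max u" "u \<noteq> v" by blast
    have inc: "(u, v) \<notin> r" "(v, u) \<notin> r" using u v by blast+
    have only: "z = u \<or> z = v" if z: "?max z" for z
    proof (rule ccontr)
      assume n: "\<not> (z = u \<or> z = v)"
      then have "antichain r {u, v, z}"
        using u v z inc unfolding antichain_def by auto
      then show False
        using c n u(2) unfolding cond_c_def one_plus_one_plus_one_free_iff by blast
    qed
    show ?thesis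
    proof (cases "\<forall>x\<in>Field r. (x, v) \<notin> r \<longrightarrow> x = u")
      case True
      have "x = y" if "x \<in> Field r" "y \<in> Field r" "(x, v) \<notin> r" "(y, v) \<notin> r" for x y
        using True that by metis
      then show ?thesis using that[of v] v by blast
    next
      case False
      then obtain x where x: "x \<in> Field r" "(x, v) \<notin> r" "x \<noteq> u" by blast
      then have xu: "(x, u) \<in> r" using above[OF x(1)] only by blast
      have ally: "y = v" if y: "y \<in> Field r" "(y, u) \<notin> r" for y
      proof (rule ccontr)
        assume "y \<noteq> v"
        moreover have "(y, v) \<in> r" using y above[OF y(1)] only by blast
        ultimately have "(x, v) \<in> r \<or> (y, u) \<in> r"
          using c xu x(3) unfolding cond_c_def two_plus_two_free_iff by blast
        then show False using x(2) y(2) by blast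
      qed
      have "y = z" if "y \<in> Field r" "z \<in> Field r" "(y, u) \<notin> r" "(z, u) \<notin> r" for y z
        using ally that by metis
      then show ?thesis using that[of u] u by blast
    qed
  qed
qed

end

text \<open>The elements \<open>length w\<close> and \<open>Suc (length w)\<close> are twins.
  \<open>Skip_same\<close> excludes the first from the last element's principal ideal and
  \<open>Skip_newest\<close> the second, so transposing them is an isomorphism.\<close>

lemma word_rel_twins_swap:
  "poset_iso (word_rel (Skip_same # Skip_newest # Above_all # w))
     (word_rel (Skip_newest # Skip_newest # Above_all # w))"
proof -
  let ?m = "length w"
  define g where "g = id(?m := Suc ?m, Suc ?m := ?m)"
  have b: "bij_betw g {..<Suc (Suc (Suc ?m))} {..<Suc (Suc (Suc ?m))}"
    by (rule bij_betwI[of _ _ _ g]) (auto simp: g_def)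
  have *: "(x, y) \<in> word_rel (Skip_same # Skip_newest # Above_all # w) \<longleftrightarrow>
      (g x, g y) \<in> word_rel (Skip_newest # Skip_newest # Above_all # w)" for x y
    using word_rel_bound[of x y w] word_rel_bound[of "g x" "g y" w] word_rel_bound[of x "g y" w]
      word_rel_bound[of "g x" y w]
    by (auto simp: word_rel.simps(2) g_def split: if_splits)
  show ?thesis
    unfolding poset_iso_def Field_word_rel using b * by (intro exI[of _ g]) auto
qed

context finite_poset
begin

lemma poset_iso_word_rel_Cons:
  assumes v: "v \<in> Field r" "\<And>y. (v, y) \<in> r \<Longrightarrow> y = v"
    and f: "bij_betw f (Field r - {v}) {..<length w}"
      "\<And>x y. x \<in> Field r - {v} \<Longrightarrow> y \<in> Field r - {v} \<Longrightarrow> (x, y) \<in> r \<longleftrightarrow> (f x, f y) \<in> word_rel w"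
    and below: "\<And>x. x \<in> Field r - {v} \<Longrightarrow> (x, v) \<in> r \<longleftrightarrow> skipped (l # w) \<noteq> Some (f x)"
  shows "poset_iso r (word_rel (l # w))"
proof -
  let ?g = "f(v := length w)"
  have lt: "f x < length w" if "x \<in> Field r - {v}" for x
    using bij_betw_apply[OF f(1) that] by simp
  have "bij_betw ?g (Field r - {v}) {..<length w}"
    using f(1) by (subst bij_betw_cong[of _ _ f]) auto
  then have "bij_betw ?g ((Field r - {v}) \<union> {v}) ({..<length w} \<union> {length w})"
    by (rule bij_betw_combine) (auto simp: bij_betw_def)
  moreover have "(Field r - {v}) \<union> {v} = Field r" "{..<length w} \<union> {length w} = {..<length (l # w)}"
    using v(1) by auto
  ultimately have "bij_betw ?g (Field r) (Field (word_rel (l # w)))" by (simp add: Field_word_rel)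
  moreover have "(x, y) \<in> r \<longleftrightarrow> (?g x, ?g y) \<in> word_rel (l # w)" if xy: "x \<in> Field r" "y \<in> Field r" for x y
  proof -
    consider "y \<noteq> v" "x \<noteq> v" | "y \<noteq> v" "x = v" | "y = v" "x \<noteq> v" | "x = v" "y = v" by blast
    then show ?thesis
    proof cases
      case 1
      then show ?thesis using xy f(2) lt[of y] word_rel_Cons_less[of "f y" w "f x" l] by simp
    next
      case 2
      have "(x, y) \<notin> r" using 2 v(2) by blast
      moreover have "(length w, f y) \<notin> word_rel (l # w)"
        using word_rel_bound[of "length w" "f y" "l # w"] lt[of y] 2 xy by auto
      ultimately show ?thesis using 2 by simp
    next
      case 3
      then show ?thesis
        using xy below[of x] lt[of x] word_rel_Cons_newest[of "f x" w l] by simp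
    next
      case 4
      then show ?thesis using reflD v(1) word_rel_refl[of "length w" "l # w"] by simp
    qed
  qed
  ultimately show ?thesis unfolding poset_iso_def by blast
qed

end

lemma exists_canonical_word:
  assumes "finite_poset r" "cond_c r"
  shows "\<exists>w. canonical w \<and> length w = card (Field r) \<and> poset_iso r (word_rel w)"
  using assms
proof (induction "card (Field r)" arbitrary: r)
  case 0
  interpret finite_poset r by (rule "0.prems")
  have "Field r = {}" using 0 finite_Field by simp
  then have "r = {}" by (auto simp: Field_def)
  then show ?case using 0 by (intro exI[of _ "[]"]) (auto simp: poset_iso_def bij_betw_def)
next
  case (Suc n)
  interpret finite_poset r by (rule Suc.prems)
  have "Field r \<noteq> {}" using Suc.hyps(2) by auto
  then obtain v where v: "v \<in> Field r" and vmax: "\<And>y. (v, y) \<in> r \<Longrightarrow> y = v"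
    and uniq: "\<And>x y. x \<in> Field r \<Longrightarrow> y \<in> Field r \<Longrightarrow> (x, v) \<notin> r \<Longrightarrow> (y, v) \<notin> r \<Longrightarrow> x = y"
    using exists_above_almost_all[OF Suc.prems(2)] by metis
  let ?r = "Restr r (Field r - {v})"
  have F: "Field ?r = Field r - {v}" by (rule Field_Restr) auto
  have cF: "card (Field ?r) = n" unfolding F using v Suc.hyps(2) finite_Field by simp
  obtain w where w: "canonical w" "length w = n" "poset_iso ?r (word_rel w)"
    using Suc.hyps(1)[OF cF[symmetric] finite_poset_Restr cond_c_Restr[OF Suc.prems(2)]] cF by blast
  obtain f where fb: "bij_betw f (Field r - {v}) {..<length w}"
    and fi: "\<forall>x\<in>Field r - {v}. \<forall>y\<in>Field r - {v}. (x, y) \<in> ?r \<longleftrightarrow> (f x, f y) \<in> word_rel w"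
    using w(3) unfolding poset_iso_def F Field_word_rel by blast
  have fi': "(x, y) \<in> r \<longleftrightarrow> (f x, f y) \<in> word_rel w" if "x \<in> Field r - {v}" "y \<in> Field r - {v}" for x y
    using fi that by blast
  note ext = poset_iso_word_rel_Cons[OF v vmax fb fi']
  show ?case
  proof (cases "\<exists>u\<in>Field r. (u, v) \<notin> r")
    case False
    then have "poset_iso r (word_rel (Above_all # w))" by (intro ext) auto
    then show ?thesis using w Suc.hyps(2) by (intro exI[of _ "Above_all # w"]) auto
  next
    case True
    then obtain u where u: "u \<in> Field r" "(u, v) \<notin> r" by blast
    then have u': "u \<in> Field r - {v}" using reflD by blast
    have below: "(x, v) \<in> r \<longleftrightarrow> f x \<noteq> f u" if x: "x \<in> Field r - {v}" for x
    proof -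
      have "(x, v) \<in> r \<longleftrightarrow> x \<noteq> u" using uniq[of x u] u x by blast
      then show ?thesis using fb x u' by (auto simp: bij_betw_def inj_on_def)
    qed
    have fu: "f u < length w" using bij_betw_apply[OF fb u'] by simp
    \<comment> \<open>By transitivity, an element above \<open>u\<close> is not below
      \<open>v\<close> either, so it is the same exception. Hence \<open>u\<close> is maximal in the
      remaining poset, and its image is the newest or the skipped element of
      \<open>w\<close>.\<close>
    have "j = f u" if j: "(f u, j) \<in> word_rel w" for j
    proof -
      have "j < length w" using word_rel_bound[OF j] by simp
      then have "j \<in> f ` (Field r - {v})" using fb by (simp add: bij_betw_def)
      then obtain y where y: "y \<in> Field r - {v}" "j = f y" by blast
      then have "(u, y) \<in> r" using fi' u' j by simp
      then have "(y, v) \<notin> r" using u(2) transD by blast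
      then have "y = u" using uniq[of y u] u y by blast
      then show ?thesis using y by simp
    qed
    then consider "f u = length w - 1" | "skipped w = Some (f u)"
      using maximal_word_rel[OF fu] by blast
    then show ?thesis
    proof cases
      case 1
      have "w \<noteq> []" using fu by auto
      moreover have "poset_iso r (word_rel (Skip_newest # w))"
        using below 1 \<open>w \<noteq> []\<close> by (intro ext) auto
      ultimately show ?thesis using w Suc.hyps(2) by (intro exI[of _ "Skip_newest # w"]) auto
    next
      case 2
      have same: "poset_iso r (word_rel (Skip_same # w))"
        using below 2 by (intro ext) auto
      show ?thesis
      proof (cases "top_shape w")
        case Single
        then show ?thesis using 2 top_shape_Single_iff[OF w(1)] by simp
      next
        \<comment> \<open>\<open>Skip_same\<close> is not canonical here; swapping the twins turns
          it into \<open>Skip_newest\<close>.\<close>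
        case Twins
        then obtain x where x: "w = Skip_newest # Above_all # x"
          using top_shape_TwinsE[OF w(1)] by blast
        then have "poset_iso r (word_rel (Skip_newest # w))"
          using same word_rel_twins_swap poset_iso_trans by blast
        then show ?thesis using w Suc.hyps(2) x by (intro exI[of _ "Skip_newest # w"]) auto
      next
        case Skew
        then show ?thesis using w Suc.hyps(2) same by (intro exI[of _ "Skip_same # w"]) auto
      qed
    qed
  qed
qed

section \<open>Indecomposable posets and their words\<close>

lemma nontrivial_ordinal_sum_iso:
  assumes "finite_poset r" "finite_poset s" "poset_iso r s" "nontrivial_ordinal_sum r"
  shows "nontrivial_ordinal_sum s"
proof -
  obtain f where f: "bij_betw f (Field r) (Field s)"
    "\<forall>x\<in>Field r. \<forall>y\<in>Field r. (x, y) \<in> r \<longleftrightarrow> (f x, f y) \<in> s"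
    using assms(3) by (auto simp: poset_iso_def)
  obtain A where A: "A \<subseteq> Field r" "A \<noteq> {}" "A \<noteq> Field r" "A \<times> (Field r - A) \<subseteq> r"
    using assms(4) unfolding finite_poset.nontrivial_ordinal_sum_iff[OF assms(1)] by blast
  have inj: "inj_on f (Field r)" and im: "f ` Field r = Field s" using f(1) by (auto simp: bij_betw_def)
  have d: "Field s - f ` A = f ` (Field r - A)"
    unfolding im[symmetric] using inj_on_image_set_diff[OF inj Diff_subset A(1)] by simp
  have "f ` A \<times> (Field s - f ` A) \<subseteq> s"
    unfolding d
  proof (rule subrelI)
    fix x y assume "(x, y) \<in> f ` A \<times> f ` (Field r - A)"
    then obtain a b where ab: "a \<in> A" "b \<in> Field r - A" "x = f a" "y = f b" by blast
    then have "(a, b) \<in> r" using A(4) by blast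
    then show "(x, y) \<in> s" using f(2) ab A(1) by blast
  qed
  moreover have "Field s - f ` A \<noteq> {}" unfolding d using A by blast
  then have "f ` A \<noteq> Field s" by blast
  moreover have "f ` A \<subseteq> Field s" "f ` A \<noteq> {}" using A im by auto
  ultimately show ?thesis
    unfolding finite_poset.nontrivial_ordinal_sum_iff[OF assms(2)] by (intro exI[of _ "f ` A"] conjI)
qed

text \<open>The oldest letter is exempt, because it is \<open>Above_all\<close> in every nonempty
  canonical word.\<close>

fun irreducible_word :: "step list \<Rightarrow> bool" where
  "irreducible_word [] = True"
| "irreducible_word (l # w) = (w = [] \<or> l \<noteq> Above_all \<and> irreducible_word w)"

lemma nontrivial_ordinal_sum_word_rel:
  "nontrivial_ordinal_sum (word_rel w) \<longleftrightarrow>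
    (\<exists>A \<subseteq> {..<length w}. A \<noteq> {} \<and> A \<noteq> {..<length w} \<and> (\<forall>x\<in>A. \<forall>y\<in>{..<length w} - A. (x, y) \<in> word_rel w))"
proof -
  have "A \<times> B \<subseteq> r \<longleftrightarrow> (\<forall>x\<in>A. \<forall>y\<in>B. (x, y) \<in> r)" for A B :: "nat set" and r by blast
  then show ?thesis
    unfolding finite_poset.nontrivial_ordinal_sum_iff[OF finite_poset_word_rel] Field_word_rel by simp
qed

text \<open>On a nonempty word \<open>Above_all\<close> adds a top summand. A split of
  \<open>w\<close> extends by putting the new element into the upper part, since the skipped element
  is maximal and thus outside the lower part. If an element is skipped, a split of
  \<open>l # w\<close> restricts to \<open>w\<close>: the skipped element is again outside the lower
  part and keeps the upper part nonempty.\<close>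

lemma irreducible_word_iff:
  "canonical w \<Longrightarrow> \<not> nontrivial_ordinal_sum (word_rel w) \<longleftrightarrow> irreducible_word w"
proof (induction w)
  case Nil
  then show ?case unfolding nontrivial_ordinal_sum_word_rel by simp
next
  case (Cons l w)
  let ?n = "length w"
  have IH: "\<not> nontrivial_ordinal_sum (word_rel w) \<longleftrightarrow> irreducible_word w"
    using Cons canonical_Cons by blast
  show ?case
  proof
    assume irr: "\<not> nontrivial_ordinal_sum (word_rel (l # w))"
    show "irreducible_word (l # w)"
    proof (cases "w = []")
      case False
      have "l \<noteq> Above_all"
      proof
        assume l: "l = Above_all"
        have "nontrivial_ordinal_sum (word_rel (l # w))"
          unfolding nontrivial_ordinal_sum_word_rel
        proof (intro exI[of _ "{..<?n}"] conjI ballI)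
          fix x y assume "x \<in> {..<?n}" "y \<in> {..<length (l # w)} - {..<?n}"
          then have "x < ?n" "y = ?n" by auto
          then show "(x, y) \<in> word_rel (l # w)" using word_rel_Cons_newest[of x w l] l by simp
        qed (use False in auto)
        then show False using irr by blast
      qed
      moreover have "\<not> nontrivial_ordinal_sum (word_rel w)"
      proof
        assume "nontrivial_ordinal_sum (word_rel w)"
        then obtain A where A: "A \<subseteq> {..<?n}" "A \<noteq> {}" "A \<noteq> {..<?n}"
          "\<And>x y. x \<in> A \<Longrightarrow> y \<in> {..<?n} - A \<Longrightarrow> (x, y) \<in> word_rel w"
          unfolding nontrivial_ordinal_sum_word_rel by blast
        obtain b where b: "b \<in> {..<?n} - A" using A(1,3) by blast
        have "nontrivial_ordinal_sum (word_rel (l # w))"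
          unfolding nontrivial_ordinal_sum_word_rel
        proof (intro exI[of _ A] conjI ballI)
          fix x y assume x: "x \<in> A" and y: "y \<in> {..<length (l # w)} - A"
          show "(x, y) \<in> word_rel (l # w)"
          proof (cases "y < ?n")
            case True
            then show ?thesis using A(4)[OF x] y word_rel_Cons_less[of y w x l] by simp
          next
            case False
            then have "y = ?n" using y by simp
            moreover have "skipped (l # w) \<noteq> Some x"
              using skipped_Cons_maximal[of l w x b] A(4)[OF x b] x b by blast
            moreover have "x < ?n" using x A(1) by blast
            ultimately show ?thesis using word_rel_Cons_newest[of x w l] by simp
          qed
        qed (use A in auto)
        then show False using irr by blast
      qed
      ultimately show ?thesis using IH by simp
    qed simp
  next
    assume irr: "irreducible_word (l # w)"
    show "\<not> nontrivial_ordinal_sum (word_rel (l # w))"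
    proof
      assume "nontrivial_ordinal_sum (word_rel (l # w))"
      then obtain A where A: "A \<subseteq> {..<Suc ?n}" "A \<noteq> {}" "A \<noteq> {..<Suc ?n}"
        "\<And>x y. x \<in> A \<Longrightarrow> y \<in> {..<Suc ?n} - A \<Longrightarrow> (x, y) \<in> word_rel (l # w)"
        unfolding nontrivial_ordinal_sum_word_rel by auto
      have nA: "?n \<notin> A"
      proof
        assume n: "?n \<in> A"
        obtain y where y: "y \<in> {..<Suc ?n} - A" using A(1,3) by blast
        then have "?n \<le> y" using A(4)[OF n y] word_rel_bound by blast
        then show False using y n by (metis DiffD1 DiffD2 lessThan_iff less_Suc_eq_le le_antisym)
      qed
      then have sub: "A \<subseteq> {..<?n}" using A(1) by (auto simp: subset_iff less_Suc_eq)
      then have "w \<noteq> []" using A(2) by auto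
      then have l: "l \<noteq> Above_all" "\<not> nontrivial_ordinal_sum (word_rel w)" using irr IH by auto
      obtain u where u: "skipped (l # w) = Some u"
        using l(1) skipped_None_iff[OF Cons.prems] by (cases "skipped (l # w)") auto
      then have un: "u < ?n" using skipped_less[OF u] by simp
      have "u \<notin> A"
        using A(4)[of u ?n] nA u word_rel_Cons_newest[of u w l] by auto
      then have "A \<noteq> {..<?n}" using un by blast
      moreover have "(x, y) \<in> word_rel w" if "x \<in> A" "y \<in> {..<?n} - A" for x y
        using A(4)[of x y] that word_rel_Cons_less[of y w x l] by simp
      ultimately have "nontrivial_ordinal_sum (word_rel w)"
        unfolding nontrivial_ordinal_sum_word_rel using sub A(2) by blast
      then show False using l(2) by blast
    qed
  qed
qed

text \<open>\<open>W\<close> indexes one representative for each class that meets \<open>X\<close>.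
  Isomorphism relates arbitrary relations on the type, so the classes themselves need not be
  contained in \<open>X\<close>.\<close>

lemma card_quotient_poset_iso:
  fixes R :: "'w \<Rightarrow> 'a rel"
  assumes "\<And>w. w \<in> W \<Longrightarrow> R w \<in> X" "\<And>r. r \<in> X \<Longrightarrow> \<exists>w\<in>W. poset_iso r (R w)"
    "\<And>w w'. w \<in> W \<Longrightarrow> w' \<in> W \<Longrightarrow> poset_iso (R w) (R w') \<Longrightarrow> w = w'"
  shows "card (X // {(r, s). poset_iso r s}) = card W"
proof -
  let ?E = "{(r, s). poset_iso r s} :: ('a rel \<times> 'a rel) set"
  have cls: "?E `` {r} = ?E `` {s} \<longleftrightarrow> poset_iso r s" for r s
    using poset_iso_refl poset_iso_sym poset_iso_trans by (auto simp: set_eq_iff) blast+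
  have "inj_on (\<lambda>w. ?E `` {R w}) W" unfolding inj_on_def cls using assms(3) by blast
  moreover have "(\<lambda>w. ?E `` {R w}) ` W = X // ?E"
  proof (intro equalityI subsetI)
    fix c assume "c \<in> (\<lambda>w. ?E `` {R w}) ` W"
    then obtain w where "w \<in> W" "c = ?E `` {R w}" by blast
    then show "c \<in> X // ?E" by (simp only: quotientI[OF assms(1)])
  next
    fix c assume "c \<in> X // ?E"
    then obtain r where r: "r \<in> X" "c = ?E `` {r}" by (rule quotientE)
    obtain w where "w \<in> W" "poset_iso r (R w)" using assms(2)[OF r(1)] by blast
    then show "c \<in> (\<lambda>w. ?E `` {R w}) ` W" using r(2) cls[of r "R w"] by blast
  qed
  ultimately show ?thesis by (metis card_image)
qed

lemma cond_c_imp_all: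
  assumes "finite_poset r" "cond_c r"
  shows "cond_a r \<and> cond_b r \<and> cond_c r"
proof -
  interpret finite_poset r by (rule assms)
  show ?thesis using assms(2) cond_b_iff_cond_c cond_a_iff_cond_b by blast
qed

section \<open>Counting words\<close>

text \<open>Apart from the empty word, the letters that may extend a canonical word, and the
  resulting shapes, depend only on its shape. Counting by shape therefore gives a linear
  recursion.\<close>

definition words :: "nat \<Rightarrow> shape \<Rightarrow> step list set" where
  "words n t = {w. canonical w \<and> length w = n \<and> top_shape w = t}"

definition irreducible_words :: "nat \<Rightarrow> shape \<Rightarrow> step list set" where
  "irreducible_words n t = {w \<in> words n t. irreducible_word w}"

lemma finite_words: "finite (words n t)"
proof (rule finite_subset)
  show "words n t \<subseteq> {w. set w \<subseteq> {Above_all, Skip_newest, Skip_same} \<and> length w = n}"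
    using step.exhaust by (auto simp: words_def)
  show "finite {w. set w \<subseteq> {Above_all, Skip_newest, Skip_same} \<and> length w = n}"
    by (intro finite_lists_length_eq) auto
qed

lemma finite_irreducible_words: "finite (irreducible_words n t)"
  using finite_words by (simp add: irreducible_words_def)

lemma card_by_shape:
  assumes "\<And>t. finite {w. P w \<and> top_shape w = t}"
  shows "card {w. P w} = card {w. P w \<and> top_shape w = Single} + card {w. P w \<and> top_shape w = Twins}
    + card {w. P w \<and> top_shape w = Skew}"
proof -
  have eq: "{w. P w} = ({w. P w \<and> top_shape w = Single} \<union> {w. P w \<and> top_shape w = Twins})
      \<union> {w. P w \<and> top_shape w = Skew}"
    using shape.exhaust by auto
  have "card {w. P w} = card ({w. P w \<and> top_shape w = Single} \<union> {w. P w \<and> top_shape w = Twins})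
      + card {w. P w \<and> top_shape w = Skew}"
    by (subst eq, rule card_Un_disjoint) (use assms in auto)
  also have "card ({w. P w \<and> top_shape w = Single} \<union> {w. P w \<and> top_shape w = Twins}) =
      card {w. P w \<and> top_shape w = Single} + card {w. P w \<and> top_shape w = Twins}"
    by (rule card_Un_disjoint) (use assms in auto)
  finally show ?thesis .
qed

lemma f_num_eq: "f_num n = card (words n Single) + card (words n Twins) + card (words n Skew)"
proof -
  have "f_num n = card {w. canonical w \<and> length w = n}"
    unfolding f_num_def num_iso_classes_def
  proof (rule card_quotient_poset_iso)
    fix w assume "w \<in> {w. canonical w \<and> length w = n}"
    then show "word_rel w \<in> {r. Partial_order r \<and> Field r = {..<n} \<and> cond_a r \<and> cond_b r \<and> cond_c r}"
      using cond_c_imp_all[OF finite_poset_word_rel cond_c_word_rel, of w]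
        finite_poset.partial_order[OF finite_poset_word_rel, of w] by (simp add: Field_word_rel)
  next
    fix r :: "nat rel"
    assume "r \<in> {r. Partial_order r \<and> Field r = {..<n} \<and> cond_a r \<and> cond_b r \<and> cond_c r}"
    then have *: "Partial_order r" "Field r = {..<n}" "cond_c r" by blast+
    then have r: "finite_poset r" "cond_c r" "card (Field r) = n" by (simp_all add: finite_poset_def)
    show "\<exists>w\<in>{w. canonical w \<and> length w = n}. poset_iso r (word_rel w)"
      using exists_canonical_word[OF r(1,2)] r(3) by blast
  qed (use canonical_word_rel_inj in blast)
  also have "\<dots> = card (words n Single) + card (words n Twins) + card (words n Skew)"
    using card_by_shape[of "\<lambda>w. canonical w \<and> length w = n"] finite_words
    by (simp add: words_def conj_assoc)
  finally show ?thesis .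
qed

lemma g_num_eq:
  "g_num n = card (irreducible_words n Single) + card (irreducible_words n Twins)
    + card (irreducible_words n Skew)"
proof -
  let ?W = "{w. canonical w \<and> length w = n \<and> irreducible_word w}"
  have "g_num n = card ?W"
    unfolding g_num_def num_iso_classes_def
  proof (rule card_quotient_poset_iso)
    fix w assume "w \<in> ?W"
    then show "word_rel w \<in> {r. Partial_order r \<and> Field r = {..<n} \<and>
        cond_a r \<and> cond_b r \<and> cond_c r \<and> \<not> nontrivial_ordinal_sum r}"
      using cond_c_imp_all[OF finite_poset_word_rel cond_c_word_rel, of w] irreducible_word_iff[of w]
        finite_poset.partial_order[OF finite_poset_word_rel, of w] by (simp add: Field_word_rel)
  next
    fix r :: "nat rel"
    assume "r \<in> {r. Partial_order r \<and> Field r = {..<n} \<and>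
        cond_a r \<and> cond_b r \<and> cond_c r \<and> \<not> nontrivial_ordinal_sum r}"
    then have *: "Partial_order r" "Field r = {..<n}" "cond_c r" "\<not> nontrivial_ordinal_sum r" by blast+
    then have r: "finite_poset r" "cond_c r" "card (Field r) = n" "\<not> nontrivial_ordinal_sum r"
      by (simp_all add: finite_poset_def)
    obtain w where w: "canonical w" "length w = n" "poset_iso r (word_rel w)"
      using exists_canonical_word[OF r(1,2)] r(3) by blast
    then have "\<not> nontrivial_ordinal_sum (word_rel w)"
      using nontrivial_ordinal_sum_iso[OF finite_poset_word_rel r(1) poset_iso_sym] r(4) by blast
    then show "\<exists>w\<in>?W. poset_iso r (word_rel w)"
      using w irreducible_word_iff by blast
  qed (use canonical_word_rel_inj in blast)
  also have "\<dots> = card (irreducible_words n Single) + card (irreducible_words n Twins)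
      + card (irreducible_words n Skew)"
    using card_by_shape[of "\<lambda>w. canonical w \<and> length w = n \<and> irreducible_word w"] finite_irreducible_words
    by (simp add: irreducible_words_def words_def conj_ac)
  finally show ?thesis .
qed

lemma words_0: "words 0 Single = {[]}" "words 0 Twins = {}" "words 0 Skew = {}"
  by (auto simp: words_def)

text \<open>The exception at \<open>n = 0\<close> arises because the empty word counts as
  \<open>Single\<close> but admits no \<open>Skip_newest\<close>.\<close>

lemma words_Suc:
  "words (Suc n) Single = Cons Above_all ` (words n Single \<union> words n Twins \<union> words n Skew)"
  "words (Suc n) Twins = (if n = 0 then {} else Cons Skip_newest ` words n Single)"
  "words (Suc n) Skew = Cons Skip_newest ` (words n Twins \<union> words n Skew) \<union> Cons Skip_same ` words n Skew"
proof -
  have step: "w \<in> words (Suc n) t \<longleftrightarrow>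
    (\<exists>l v. w = l # v \<and> canonical (l # v) \<and> length v = n \<and> top_shape (l # v) = t)" for w t
    by (cases w) (auto simp: words_def)
  show "words (Suc n) Single = Cons Above_all ` (words n Single \<union> words n Twins \<union> words n Skew)"
  proof (rule set_eqI)
    fix w
    show "w \<in> words (Suc n) Single \<longleftrightarrow> w \<in> Cons Above_all ` (words n Single \<union> words n Twins \<union> words n Skew)"
    proof
      assume "w \<in> words (Suc n) Single"
      then obtain l v where "w = l # v" "canonical (l # v)" "length v = n" "top_shape (l # v) = Single"
        unfolding step by blast
      then show "w \<in> Cons Above_all ` (words n Single \<union> words n Twins \<union> words n Skew)"
        by (cases l; cases "top_shape v") (auto simp: words_def)
    qed (auto simp: words_def)
  qed
  show "words (Suc n) Twins = (if n = 0 then {} else Cons Skip_newest ` words n Single)"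
  proof (rule set_eqI)
    fix w
    show "w \<in> words (Suc n) Twins \<longleftrightarrow> w \<in> (if n = 0 then {} else Cons Skip_newest ` words n Single)"
    proof
      assume "w \<in> words (Suc n) Twins"
      then obtain l v where "w = l # v" "canonical (l # v)" "length v = n" "top_shape (l # v) = Twins"
        unfolding step by blast
      then show "w \<in> (if n = 0 then {} else Cons Skip_newest ` words n Single)"
        by (cases l; cases "top_shape v") (auto simp: words_def)
    qed (auto simp: words_def split: if_splits)
  qed
  show "words (Suc n) Skew = Cons Skip_newest ` (words n Twins \<union> words n Skew) \<union> Cons Skip_same ` words n Skew"
  proof (rule set_eqI)
    fix w
    show "w \<in> words (Suc n) Skew \<longleftrightarrow>
      w \<in> Cons Skip_newest ` (words n Twins \<union> words n Skew) \<union> Cons Skip_same ` words n Skew"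
    proof
      assume "w \<in> words (Suc n) Skew"
      then obtain l v where "w = l # v" "canonical (l # v)" "length v = n" "top_shape (l # v) = Skew"
        unfolding step by blast
      then show "w \<in> Cons Skip_newest ` (words n Twins \<union> words n Skew) \<union> Cons Skip_same ` words n Skew"
        by (cases l; cases "top_shape v") (auto simp: words_def)
    qed (auto simp: words_def)
  qed
qed

lemma words_disjoint: "t \<noteq> t' \<Longrightarrow> words n t \<inter> words n t' = {}"
  by (auto simp: words_def)

lemma card_words_Suc:
  "card (words (Suc n) Single) = f_num n"
  "card (words (Suc (Suc n)) Twins) = card (words (Suc n) Single)"
  "card (words (Suc n) Skew) = card (words n Twins) + 2 * card (words n Skew)"
proof -
  have "card (words n Single \<union> words n Twins \<union> words n Skew) = f_num n"
    unfolding f_num_eq using words_disjoint[of _ _ n] finite_words[of n]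
    by (simp add: card_Un_disjoint Int_Un_distrib2)
  then show "card (words (Suc n) Single) = f_num n"
    unfolding words_Suc by (simp add: card_image)
  show "card (words (Suc (Suc n)) Twins) = card (words (Suc n) Single)"
    unfolding words_Suc(2) by (simp add: card_image)
  have "card (words (Suc n) Skew) =
      card (Cons Skip_newest ` (words n Twins \<union> words n Skew)) + card (Cons Skip_same ` words n Skew)"
    unfolding words_Suc(3) using finite_words by (intro card_Un_disjoint) auto
  also have "\<dots> = card (words n Twins) + 2 * card (words n Skew)"
    using words_disjoint[of Twins Skew n] finite_words by (simp add: card_image card_Un_disjoint)
  finally show "card (words (Suc n) Skew) = card (words n Twins) + 2 * card (words n Skew)" .
qed

lemma f_num_small: "f_num 0 = 1" "f_num 1 = 1" "f_num 2 = 2"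
proof -
  have t1: "words (Suc 0) Twins = {}" by (simp add: words_Suc)
  show f0: "f_num 0 = 1" by (simp add: f_num_eq words_0)
  show f1: "f_num 1 = 1"
    by (simp add: f_num_eq[of "Suc 0"] card_words_Suc t1 words_0 f0)
  show "f_num 2 = 2"
    using f0 f1 by (simp add: numeral_2_eq_2 f_num_eq[of "Suc (Suc 0)"] card_words_Suc t1 words_0)
qed

text \<open>With K the number of \<open>Skew\<close> words of length n + 2, counting by shape gives
  f(n+2) = f(n+1) + f(n) + K and f(n+3) = f(n+2) + f(n+1) + f(n) + 2K. Eliminating K leaves the
  recurrence, arranged without subtraction on the naturals.\<close>

lemma f_num_rec: "f_num (n + 3) + f_num (n + 1) + f_num n = 3 * f_num (n + 2)"
proof -
  have "f_num (Suc (Suc n)) = f_num (Suc n) + f_num n + card (words (Suc (Suc n)) Skew)"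
    unfolding f_num_eq[of "Suc (Suc n)"] card_words_Suc(1,2) ..
  moreover have "f_num (Suc (Suc (Suc n))) = f_num (Suc (Suc n)) + f_num (Suc n)
      + (f_num n + 2 * card (words (Suc (Suc n)) Skew))"
    unfolding f_num_eq[of "Suc (Suc (Suc n))"] card_words_Suc(3)[of "Suc (Suc n)"] card_words_Suc(1,2) ..
  ultimately have "f_num (Suc (Suc (Suc n))) + f_num (Suc n) + f_num n = 3 * f_num (Suc (Suc n))"
    by linarith
  moreover have "n + 3 = Suc (Suc (Suc n))" "n + 2 = Suc (Suc n)" "n + 1 = Suc n" by simp_all
  ultimately show ?thesis by (simp only:)
qed

lemma irreducible_words_Suc:
  assumes "n > 0"
  shows "irreducible_words (Suc n) Single = {}"
    "irreducible_words (Suc n) Twins = Cons Skip_newest ` irreducible_words n Single"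
    "irreducible_words (Suc n) Skew =
      Cons Skip_newest ` (irreducible_words n Twins \<union> irreducible_words n Skew)
      \<union> Cons Skip_same ` irreducible_words n Skew"
proof -
  have ne: "w \<noteq> []" if "w \<in> words n t" for w t using that assms by (auto simp: words_def)
  show "irreducible_words (Suc n) Single = {}"
    "irreducible_words (Suc n) Twins = Cons Skip_newest ` irreducible_words n Single"
    "irreducible_words (Suc n) Skew =
      Cons Skip_newest ` (irreducible_words n Twins \<union> irreducible_words n Skew)
      \<union> Cons Skip_same ` irreducible_words n Skew"
    unfolding irreducible_words_def words_Suc using assms by (auto dest: ne)
qed

lemma irreducible_words_1:
  "irreducible_words (Suc 0) Single = {[Above_all]}" "irreducible_words (Suc 0) Twins = {}"
  "irreducible_words (Suc 0) Skew = {}"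
  unfolding irreducible_words_def words_Suc words_0 by auto

lemma card_irreducible_words_Skew:
  "n > 0 \<Longrightarrow> card (irreducible_words (Suc n) Skew) =
    card (irreducible_words n Twins) + 2 * card (irreducible_words n Skew)"
proof -
  assume n: "n > 0"
  have "card (irreducible_words (Suc n) Skew) =
      card (Cons Skip_newest ` (irreducible_words n Twins \<union> irreducible_words n Skew))
      + card (Cons Skip_same ` irreducible_words n Skew)"
    unfolding irreducible_words_Suc(3)[OF n] using finite_irreducible_words
    by (intro card_Un_disjoint) auto
  moreover have "irreducible_words n Twins \<inter> irreducible_words n Skew = {}"
    using words_disjoint[of Twins Skew n] by (auto simp: irreducible_words_def)
  ultimately show ?thesis
    using finite_irreducible_words by (simp add: card_image card_Un_disjoint)
qed

text \<open>The only word of length 2 to count is the pair of twins. It has a single admissible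
  extension, which is \<open>Skew\<close>, and from then on each word has exactly two, both
  \<open>Skew\<close>.\<close>

lemma card_irreducible_words:
  "irreducible_words (n + 3) Single = {}" "irreducible_words (n + 3) Twins = {}"
  "card (irreducible_words (n + 3) Skew) = 2 ^ n"
proof -
  have 2: "irreducible_words (Suc (Suc 0)) Single = {}"
    "irreducible_words (Suc (Suc 0)) Twins = {[Skip_newest, Above_all]}"
    "irreducible_words (Suc (Suc 0)) Skew = {}"
    by (simp_all add: irreducible_words_Suc irreducible_words_1)
  show e: "irreducible_words (n + 3) Single = {}" "irreducible_words (n + 3) Twins = {}" for n
    by (simp_all add: irreducible_words_Suc numeral_3_eq_3)
  show "card (irreducible_words (n + 3) Skew) = 2 ^ n"
  proof (induction n)
    case 0
    show ?case
      using card_irreducible_words_Skew[of "Suc (Suc 0)"] by (simp add: 2 numeral_3_eq_3)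
  next
    case (Suc n)
    then show ?case using card_irreducible_words_Skew[of "n + 3"] e(2)[of n] by simp
  qed
qed

lemma g_num_values: "g_num 1 = 1" "g_num 2 = 1" "n \<ge> 3 \<Longrightarrow> g_num n = 2 ^ (n - 3)"
proof -
  show "g_num 1 = 1" by (simp add: g_num_eq irreducible_words_1)
  show "g_num 2 = 1"
    by (simp add: g_num_eq numeral_2_eq_2 irreducible_words_Suc irreducible_words_1)
  show "g_num n = 2 ^ (n - 3)" if "n \<ge> 3"
    using card_irreducible_words[of "n - 3"] that by (simp add: g_num_eq)
qed

section \<open>The generating function\<close>

lemma f_num_fps:
  "Abs_fps (\<lambda>n. of_nat (f_num n)) =
    ((1 - 2 * fps_X) / ((1 - fps_X) * (1 - 2 * fps_X - fps_X ^ 2)) :: rat fps)"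
proof -
  let ?F = "Abs_fps (\<lambda>n. of_nat (f_num n)) :: rat fps"
  let ?D = "(1 - fps_X) * (1 - 2 * fps_X - fps_X ^ 2) :: rat fps"
  \<comment> \<open>The denominator expands to 1 - 3X + X^2 + X^3. By \<open>f_num_rec\<close> the
    product has no coefficients from degree 3 on, and f(0), f(1), f(2) = 1, 1, 2 give the
    numerator.\<close>
  have D: "?F * ?D = ?F - 3 * (?F * fps_X) + ?F * fps_X ^ 2 + ?F * fps_X ^ 3"
    by (simp add: algebra_simps power2_eq_square power3_eq_cube)
  have "?F * ?D = 1 - 2 * fps_X"
  proof (rule fps_ext)
    fix n :: nat
    consider "n = 0" | "n = 1" | "n = 2" | "3 \<le> n" by linarith
    then show "fps_nth (?F * ?D) n = fps_nth (1 - 2 * fps_X) n"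
    proof cases
      case 4
      then obtain m where n: "n = m + 3" using le_Suc_ex by (metis add.commute)
      have "rat_of_nat (f_num (m + 3) + f_num (m + 1) + f_num m) = rat_of_nat (3 * f_num (m + 2))"
        by (simp only: f_num_rec)
      then show ?thesis
        unfolding D using n
        by (simp add: fps_numeral_fps_const fps_X_power_mult_right_nth)
    qed (unfold D, use f_num_small in \<open>simp_all add: fps_numeral_fps_const fps_X_power_mult_right_nth\<close>)
  qed
  moreover have "?D \<noteq> 0"
  proof
    assume "?D = 0"
    then have "fps_nth ?D 0 = 0" by (simp only: fps_zero_nth)
    then show False by simp
  qed
  ultimately show ?thesis by (metis nonzero_mult_div_cancel_right)
qed

theorem theorem3p4:
  shows
    "(\<forall>(r :: 'a rel) n. Partial_order r \<and> finite (Field r) \<and> card (Field r) = n \<longrightarrow>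
        (cond_a r \<longleftrightarrow> cond_b r) \<and>
        (cond_b r \<longleftrightarrow> cond_c r) \<and>
        (cond_a r \<longrightarrow> (\<forall>S \<subseteq> {1..n - 1}. flag_h (ideal_lattice r) S \<noteq> 0 \<longrightarrow> sparse S)) \<and>
        (cond_b r \<longleftrightarrow> (\<forall>i\<in>{0..n}. card {I \<in> order_ideals r. card I = i} \<le> 2)) \<and>
        (cond_a r \<and> cond_b r \<and> cond_c r \<longrightarrow>
          (\<not> nontrivial_ordinal_sum r \<longleftrightarrow>
            (\<forall>i\<in>{1..n - 1}. card {I \<in> Field (ideal_lattice r). elem_rank (ideal_lattice r) I = i} = 2)))) \<and>
     f_num 0 = 1 \<and>
     Abs_fps (\<lambda>n. of_nat (f_num n)) =
       ((1 - 2 * fps_X) / ((1 - fps_X) * (1 - 2 * fps_X - fps_X ^ 2)) :: rat fps) \<and>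
     g_num 1 = 1 \<and> g_num 2 = 1 \<and> (\<forall>n\<ge>3. g_num n = 2 ^ (n - 3))"
proof (intro conjI allI impI; (elim conjE)?)
  fix r :: "'a rel" and n
  assume r: "Partial_order r" "finite (Field r)" "card (Field r) = n"
  interpret finite_poset r using r by (simp add: finite_poset_def)
  show "cond_a r \<longleftrightarrow> cond_b r" by (rule cond_a_iff_cond_b)
  show "cond_b r \<longleftrightarrow> cond_c r" by (rule cond_b_iff_cond_c)
  show "sparse S" if "cond_a r" "S \<subseteq> {1..n - 1}" "flag_h (ideal_lattice r) S \<noteq> 0" for S
    using that cond_b_imp_flag_h_below(2) r(3) unfolding cond_a_iff_cond_b flag_h_eq by blast
  show "cond_b r \<longleftrightarrow> (\<forall>i\<in>{0..n}. card {I \<in> order_ideals r. card I = i} \<le> 2)"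
    unfolding cond_b_def rank_set_eq_level level_def r(3) ..
  show "\<not> nontrivial_ordinal_sum r \<longleftrightarrow>
      (\<forall>i\<in>{1..n - 1}. card {I \<in> Field (ideal_lattice r). elem_rank (ideal_lattice r) I = i} = 2)"
    if "cond_b r"
    using irreducible_iff_level[OF that] unfolding rank_set_eq_level r(3) .
qed (use f_num_small f_num_fps g_num_values in blast)+

end
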